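(* Let $(M^{2m+1},\theta,J,h)$ be a pseudo-Hermitian manifold with its canonical pseudo-Hermitian connection $\nabla$. Then $M$ is of pseudo-Kähler type if and only if $\Theta^{(2,0)}=0$, $\sigma=0$ and $\tau$ is symmetric with respect to $g_{h,\theta}$.
   Context: All objects are smooth. For a $1$-form, $2d\theta(X,Y)=X(\theta(Y))-Y(\theta(X))-\theta([X,Y])$. A CR structure on an orientable manifold $M$ of dimension $2m+1$ is a complex rank-$m$ subbundle $H^{1,0}(M)\subset T(M)\otimes\mathbb C$ with $H^{1,0}(M)\cap H^{0,1}(M)=\{0\}$, where $H^{0,1}(M)=\overline{H^{1,0}(M)}$, and $[\Gamma(H^{1,0}(M)),\Gamma(H^{1,0}(M))]\subseteq\Gamma(H^{1,0}(M))$. Put $H(M)=\mathrm{Re}(H^{1,0}(M)\oplus H^{0,1}(M))$ and $J_b(Z+\overline Z)=\sqrt{-1}(Z-\overline Z)$ for $Z\in H^{1,0}(M)$. A pseudo-Hermitian $1$-form is a nowhere vanishing real $1$-form $\theta$ with $\ker\theta=H(M)$; its Levi form is $L_\theta(X,Y)=d\theta(X,J_bY)$ on $H(M)$. The CR manifold is non-degenerate if $L_\theta$ is non-degenerate. Then there is a unique (Reeb) vector field $\xi$ with $\theta(\xi)=1$, $i_\xi d\theta=0$; $T(M)=H(M)\oplus\mathbb R\xi$ with projection $\pi_H:T(M)\to H(M)$, and $J$ is the endomorphism of $T(M)$ with $J|_{H(M)}=J_b$, $J\xi=0$. A pseudo-Hermitian manifold $(M,\theta,J,h)$ is a non-degenerate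 CR manifold with a fixed pseudo-Hermitian $1$-form $\theta$ and a (positive definite) fiber metric $h$ on $H(M)$ with $h(J_bX,J_bY)=h(X,Y)$. The symbol $h$ also denotes the tensor $h(\pi_H\cdot,\pi_H\cdot)$ on $M$; $g_{h,\theta}=h+\theta\otimes\theta$ is a Riemannian metric. The pseudo-Kähler form is $\Omega_{h,\theta}(X,Y)=g_{h,\theta}(JX,Y)$; $M$ is of pseudo-Kähler type if $d\Omega_{h,\theta}=0$. There is the decomposition $T(M)\otimes\mathbb C=H^{1,0}(M)\oplus H^{0,1}(M)\oplus\mathbb C\xi$ with projections $\pi_+,\pi_-,\pi_0$. A pseudo-Hermitian connection is a linear connection $\nabla$ on $M$ preserving this decomposition and satisfying $\nabla g_{h,\theta}=0$. Its torsion is $T_\nabla(X,Y)=\nabla_XY-\nabla_YX-[X,Y]$, extended complex bilinearly. With $\Theta=\pi_+(T_\nabla(\cdot,\cdot))$, set $\Theta^{(2,0)}(Z,W)=\Theta(\pi_+Z,\pi_+W)$ and $\Theta^{(1,1)}(Z,W)=\Theta(\pi_+Z,\pi_-W)+\Theta(\pi_-Z,\pi_+W)$. Also $\tau(X)=T_\nabla(\xi,X)$ and $\sigma=\tau\circ J+J\circ\tau$. The canonical pseudo-Hermitian connection is the unique pseudo-Hermitian connection with $\Theta^{(1,1)}=0$ and $h(\sigma(X),Y)=-h(X,\sigma(Y))$ for all $X,Y\in T(M)$. *)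

theory Defs
  imports "HOL-Analysis.Analysis" "HOL-Library.Function_Algebras"
begin

section \<open>Smooth manifolds\<close>

(* A manifold is a whole (Hausdorff, second countable) type together with a smooth atlas. *)

primrec Ck_on :: "nat \<Rightarrow> 's::real_normed_vector set \<Rightarrow> ('s \<Rightarrow> 't::real_normed_vector) \<Rightarrow> bool" where
  "Ck_on 0 S f \<longleftrightarrow> continuous_on S f"
| "Ck_on (Suc k) S f \<longleftrightarrow> (\<forall>x\<in>S. f differentiable (at x)) \<and>
     (\<forall>v. Ck_on k S (\<lambda>x. frechet_derivative f (at x) v))"

(* Only used for open S, since derivatives are taken in the full space. *)
definition Cinf_on :: "'s::real_normed_vector set \<Rightarrow> ('s \<Rightarrow> 't::real_normed_vector) \<Rightarrow> bool" where
  "Cinf_on S f \<longleftrightarrow> (\<forall>k. Ck_on k S f)"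

type_synonym ('a, 'n) chart = "'a set \<times> ('a \<Rightarrow> real ^ 'n)"

definition is_chart :: "('a::topological_space, 'n::finite) chart \<Rightarrow> bool" where
  "is_chart c \<longleftrightarrow> (case c of (U, \<phi>) \<Rightarrow>
     open U \<and> open (\<phi> ` U) \<and> (\<exists>\<psi>. homeomorphism U (\<phi> ` U) \<phi> \<psi>))"

definition transition :: "('a, 'n::finite) chart \<Rightarrow> ('a, 'n) chart \<Rightarrow> real ^ 'n \<Rightarrow> real ^ 'n" where
  "transition c d = snd d \<circ> inv_into (fst c) (snd c)"

definition smooth_atlas :: "('a::topological_space, 'n::finite) chart set \<Rightarrow> bool" where
  "smooth_atlas A \<longleftrightarrow> (\<forall>c\<in>A. is_chart c) \<and> (\<Union>c\<in>A. fst c) = UNIV \<and>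
     (\<forall>c\<in>A. \<forall>d\<in>A. Cinf_on (snd c ` (fst c \<inter> fst d)) (transition c d))"

definition orientable :: "('a::topological_space, 'n::finite) chart set \<Rightarrow> bool" where
  "orientable A \<longleftrightarrow> (\<exists>B. smooth_atlas B \<and> smooth_atlas (A \<union> B) \<and>
     (\<forall>c\<in>B. \<forall>d\<in>B. \<forall>x \<in> snd c ` (fst c \<inter> fst d).
        det (jacobian (transition c d) (at x)) > 0))"

definition smooth_fun_on ::
  "('a, 'n::finite) chart set \<Rightarrow> 'a set \<Rightarrow> ('a \<Rightarrow> 'b::real_normed_vector) \<Rightarrow> bool" where
  "smooth_fun_on A S f \<longleftrightarrow>
     (\<forall>(U, \<phi>)\<in>A. Cinf_on (\<phi> ` (U \<inter> S)) (f \<circ> inv_into U \<phi>))"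

definition smooth_funs :: "('a, 'n::finite) chart set \<Rightarrow> ('a \<Rightarrow> real) set" where
  "smooth_funs A = {f. smooth_fun_on A UNIV f}"

section \<open>Tangent vectors and vector fields\<close>

(* Tangent vectors at p are the derivations at p of the algebra of smooth functions; the value on
   non-smooth arguments is fixed to 0 so that equality of tangent vectors is equality in HOL.
   An element X + iY of the complexified tangent space is the functional sending f to
   X f + i Y f. *)

type_synonym 'a tvec = "('a \<Rightarrow> real) \<Rightarrow> real"
type_synonym 'a ctvec = "('a \<Rightarrow> real) \<Rightarrow> complex"
type_synonym 'a vfield = "'a \<Rightarrow> 'a tvec"
type_synonym 'a cvfield = "'a \<Rightarrow> 'a ctvec"

definition vscale :: "'k::times \<Rightarrow> ('b \<Rightarrow> 'k) \<Rightarrow> 'b \<Rightarrow> 'k" where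
  "vscale c v = (\<lambda>f. c * v f)"

definition fscale :: "('a \<Rightarrow> 'k::times) \<Rightarrow> ('a \<Rightarrow> 'b \<Rightarrow> 'k) \<Rightarrow> 'a \<Rightarrow> 'b \<Rightarrow> 'k" where
  "fscale u X = (\<lambda>p. vscale (u p) (X p))"

definition tangent_space :: "('a, 'n::finite) chart set \<Rightarrow> 'a \<Rightarrow> 'a tvec set" where
  "tangent_space A p = {v.
     (\<forall>f\<in>smooth_funs A. \<forall>g\<in>smooth_funs A. v (f + g) = v f + v g) \<and>
     (\<forall>c. \<forall>f\<in>smooth_funs A. v (\<lambda>q. c * f q) = c * v f) \<and>
     (\<forall>f\<in>smooth_funs A. \<forall>g\<in>smooth_funs A. v (f * g) = f p * v g + g p * v f) \<and>
     (\<forall>f. f \<notin> smooth_funs A \<longrightarrow> v f = 0)}"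

definition re_vec :: "'a ctvec \<Rightarrow> 'a tvec" where "re_vec Z = (\<lambda>f. Re (Z f))"
definition im_vec :: "'a ctvec \<Rightarrow> 'a tvec" where "im_vec Z = (\<lambda>f. Im (Z f))"
definition cnj_vec :: "'a ctvec \<Rightarrow> 'a ctvec" where "cnj_vec Z = (\<lambda>f. cnj (Z f))"
definition cplx_vec :: "'a tvec \<Rightarrow> 'a ctvec" where "cplx_vec v = (\<lambda>f. complex_of_real (v f))"

definition ctangent_space :: "('a, 'n::finite) chart set \<Rightarrow> 'a \<Rightarrow> 'a ctvec set" where
  "ctangent_space A p = {Z. re_vec Z \<in> tangent_space A p \<and> im_vec Z \<in> tangent_space A p}"

definition vfields_on :: "('a, 'n::finite) chart set \<Rightarrow> 'a set \<Rightarrow> 'a vfield set" where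
  "vfields_on A U = {X. (\<forall>p\<in>U. X p \<in> tangent_space A p) \<and>
     (\<forall>f\<in>smooth_funs A. smooth_fun_on A U (\<lambda>p. X p f))}"

definition cvfields_on :: "('a, 'n::finite) chart set \<Rightarrow> 'a set \<Rightarrow> 'a cvfield set" where
  "cvfields_on A U = {Z. re_vec \<circ> Z \<in> vfields_on A U \<and> im_vec \<circ> Z \<in> vfields_on A U}"

abbreviation vfields :: "('a, 'n::finite) chart set \<Rightarrow> 'a vfield set" where
  "vfields A \<equiv> vfields_on A UNIV"

abbreviation cvfields :: "('a, 'n::finite) chart set \<Rightarrow> 'a cvfield set" where
  "cvfields A \<equiv> cvfields_on A UNIV"

definition lie_bracket :: "'a vfield \<Rightarrow> 'a vfield \<Rightarrow> 'a vfield" where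
  "lie_bracket X Y = (\<lambda>p f. X p (\<lambda>q. Y q f) - Y p (\<lambda>q. X q f))"

(* complex bilinear extension of a bilinear operation on real vector fields *)
definition cbilin :: "('a vfield \<Rightarrow> 'a vfield \<Rightarrow> 'a vfield) \<Rightarrow> 'a cvfield \<Rightarrow> 'a cvfield \<Rightarrow> 'a cvfield" where
  "cbilin B Z W = (\<lambda>p f. Complex
     (B (re_vec \<circ> Z) (re_vec \<circ> W) p f - B (im_vec \<circ> Z) (im_vec \<circ> W) p f)
     (B (re_vec \<circ> Z) (im_vec \<circ> W) p f + B (im_vec \<circ> Z) (re_vec \<circ> W) p f))"

(* Smooth global sections of a family of subspaces of the (complexified) tangent spaces. *)
definition sections :: "('a, 'n::finite) chart set \<Rightarrow> ('a \<Rightarrow> 'a tvec set) \<Rightarrow> 'a vfield set" where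
  "sections A E = {X \<in> vfields A. \<forall>p. X p \<in> E p}"

definition csections :: "('a, 'n::finite) chart set \<Rightarrow> ('a \<Rightarrow> 'a ctvec set) \<Rightarrow> 'a cvfield set" where
  "csections A E = {Z \<in> cvfields A. \<forall>p. Z p \<in> E p}"

section \<open>Differential forms\<close>

definition one_form :: "('a, 'n::finite) chart set \<Rightarrow> ('a \<Rightarrow> 'a tvec \<Rightarrow> real) \<Rightarrow> bool" where
  "one_form A \<theta> \<longleftrightarrow>
     (\<forall>p. \<forall>v\<in>tangent_space A p. \<forall>w\<in>tangent_space A p. \<theta> p (v + w) = \<theta> p v + \<theta> p w) \<and>
     (\<forall>p. \<forall>c. \<forall>v\<in>tangent_space A p. \<theta> p (vscale c v) = c * \<theta> p v) \<and>
     (\<forall>X\<in>vfields A. smooth_fun_on A UNIV (\<lambda>p. \<theta> p (X p)))"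

(* Normalised so that 2 d\<theta>(X,Y) = X(\<theta>(Y)) - Y(\<theta>(X)) - \<theta>([X,Y]) and, correspondingly,
   3 d\<omega>(X,Y,Z) is the cyclic sum of X(\<omega>(Y,Z)) - \<omega>([X,Y],Z). *)

definition ext_d1 :: "('a \<Rightarrow> 'a tvec \<Rightarrow> real) \<Rightarrow> 'a vfield \<Rightarrow> 'a vfield \<Rightarrow> 'a \<Rightarrow> real" where
  "ext_d1 \<theta> X Y p =
     (X p (\<lambda>q. \<theta> q (Y q)) - Y p (\<lambda>q. \<theta> q (X q)) - \<theta> p (lie_bracket X Y p)) / 2"

definition ext_d2 ::
  "('a \<Rightarrow> 'a tvec \<Rightarrow> 'a tvec \<Rightarrow> real) \<Rightarrow> 'a vfield \<Rightarrow> 'a vfield \<Rightarrow> 'a vfield \<Rightarrow> 'a \<Rightarrow> real" where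
  "ext_d2 \<omega> X Y Z p =
     (X p (\<lambda>q. \<omega> q (Y q) (Z q)) + Y p (\<lambda>q. \<omega> q (Z q) (X q)) + Z p (\<lambda>q. \<omega> q (X q) (Y q))
      - \<omega> p (lie_bracket X Y p) (Z p) - \<omega> p (lie_bracket Y Z p) (X p)
      - \<omega> p (lie_bracket Z X p) (Y p)) / 3"

section \<open>CR structures\<close>

definition complex_subbundle ::
  "('a::topological_space, 'n::finite) chart set \<Rightarrow> nat \<Rightarrow> ('a \<Rightarrow> 'a ctvec set) \<Rightarrow> bool" where
  "complex_subbundle A m E \<longleftrightarrow>
     (\<forall>p. E p \<subseteq> ctangent_space A p) \<and>
     (\<forall>p. \<exists>U F. open U \<and> p \<in> U \<and> (\<forall>i<m. F i \<in> cvfields_on A U) \<and>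
        (\<forall>q\<in>U. E q = range (\<lambda>c::nat \<Rightarrow> complex. \<Sum>i<m. vscale (c i) (F i q)) \<and>
               (\<forall>c::nat \<Rightarrow> complex. (\<Sum>i<m. vscale (c i) (F i q)) = 0 \<longrightarrow> (\<forall>i<m. c i = 0))))"

definition cnj_bundle :: "('a \<Rightarrow> 'a ctvec set) \<Rightarrow> 'a \<Rightarrow> 'a ctvec set" where
  "cnj_bundle E p = cnj_vec ` E p"

definition cr_structure ::
  "('a::topological_space, 'n::finite) chart set \<Rightarrow> nat \<Rightarrow> ('a \<Rightarrow> 'a ctvec set) \<Rightarrow> bool" where
  "cr_structure A m E \<longleftrightarrow> complex_subbundle A m E \<and>
     (\<forall>p. E p \<inter> cnj_bundle E p = {0}) \<and>
     (\<forall>Z\<in>csections A E. \<forall>W\<in>csections A E. cbilin lie_bracket Z W \<in> csections A E)"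

(* the real vectors in the direct sum of E and its conjugate *)
definition hor :: "('a \<Rightarrow> 'a ctvec set) \<Rightarrow> 'a \<Rightarrow> 'a tvec set" where
  "hor E p = {v. \<exists>Z\<in>E p. \<exists>W\<in>cnj_bundle E p. cplx_vec v = Z + W}"

(* Z and hence w are unique because E meets its conjugate trivially. *)
definition Jb :: "('a \<Rightarrow> 'a ctvec set) \<Rightarrow> 'a \<Rightarrow> 'a tvec \<Rightarrow> 'a tvec" where
  "Jb E p v = (THE w. \<exists>Z\<in>E p. cplx_vec v = Z + cnj_vec Z \<and>
                              cplx_vec w = vscale \<i> (Z - cnj_vec Z))"

definition pseudo_hermitian_form ::
  "('a, 'n::finite) chart set \<Rightarrow> ('a \<Rightarrow> 'a ctvec set) \<Rightarrow> ('a \<Rightarrow> 'a tvec \<Rightarrow> real) \<Rightarrow> bool" where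
  "pseudo_hermitian_form A E \<theta> \<longleftrightarrow> one_form A \<theta> \<and>
     (\<forall>p. \<exists>v\<in>tangent_space A p. \<theta> p v \<noteq> 0) \<and>
     (\<forall>p. {v \<in> tangent_space A p. \<theta> p v = 0} = hor E p)"

definition levi_form ::
  "('a \<Rightarrow> 'a ctvec set) \<Rightarrow> ('a \<Rightarrow> 'a tvec \<Rightarrow> real) \<Rightarrow> 'a vfield \<Rightarrow> 'a vfield \<Rightarrow> 'a \<Rightarrow> real" where
  "levi_form E \<theta> X Y = ext_d1 \<theta> X (\<lambda>q. Jb E q (Y q))"

(* Non-degeneracy at every point; every horizontal vector is the value of a horizontal section. *)
definition levi_nondegenerate ::
  "('a, 'n::finite) chart set \<Rightarrow> ('a \<Rightarrow> 'a ctvec set) \<Rightarrow> ('a \<Rightarrow> 'a tvec \<Rightarrow> real) \<Rightarrow> bool" where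
  "levi_nondegenerate A E \<theta> \<longleftrightarrow> (\<forall>p. \<forall>X\<in>sections A (hor E).
     (\<forall>Y\<in>sections A (hor E). levi_form E \<theta> X Y p = 0) \<longrightarrow> X p = 0)"

definition is_reeb_field ::
  "('a, 'n::finite) chart set \<Rightarrow> ('a \<Rightarrow> 'a tvec \<Rightarrow> real) \<Rightarrow> 'a vfield \<Rightarrow> bool" where
  "is_reeb_field A \<theta> \<xi> \<longleftrightarrow> \<xi> \<in> vfields A \<and> (\<forall>p. \<theta> p (\<xi> p) = 1) \<and>
     (\<forall>X\<in>vfields A. \<forall>p. ext_d1 \<theta> \<xi> X p = 0)"

definition hermitian_fiber_metric ::
  "('a, 'n::finite) chart set \<Rightarrow> ('a \<Rightarrow> 'a ctvec set) \<Rightarrow> ('a \<Rightarrow> 'a tvec \<Rightarrow> 'a tvec \<Rightarrow> real) \<Rightarrow> bool" where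
  "hermitian_fiber_metric A E h \<longleftrightarrow>
     (\<forall>p. \<forall>u\<in>hor E p. \<forall>v\<in>hor E p. \<forall>w\<in>hor E p. h p (u + v) w = h p u w + h p v w) \<and>
     (\<forall>p. \<forall>c. \<forall>u\<in>hor E p. \<forall>v\<in>hor E p. h p (vscale c u) v = c * h p u v) \<and>
     (\<forall>p. \<forall>u\<in>hor E p. \<forall>v\<in>hor E p. h p u v = h p v u) \<and>
     (\<forall>p. \<forall>u\<in>hor E p. u \<noteq> 0 \<longrightarrow> h p u u > 0) \<and>
     (\<forall>X\<in>sections A (hor E). \<forall>Y\<in>sections A (hor E). smooth_fun_on A UNIV (\<lambda>p. h p (X p) (Y p))) \<and>
     (\<forall>p. \<forall>u\<in>hor E p. \<forall>v\<in>hor E p. h p (Jb E p u) (Jb E p v) = h p u v)"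

section \<open>Pseudo-Hermitian manifolds\<close>

(* The Reeb field is determined by the 1-form; it is stored as a component for convenience and
   characterised in pseudo_hermitian_manifold. *)
record ('a, 'n::finite) pseudo_hermitian =
  charts :: "('a, 'n) chart set"
  H10 :: "'a \<Rightarrow> 'a ctvec set"
  form :: "'a \<Rightarrow> 'a tvec \<Rightarrow> real"
  hmetric :: "'a \<Rightarrow> 'a tvec \<Rightarrow> 'a tvec \<Rightarrow> real"
  reeb :: "'a vfield"

definition pseudo_hermitian_manifold ::
  "nat \<Rightarrow> ('a::{t2_space, second_countable_topology}, 'n::finite) pseudo_hermitian \<Rightarrow> bool" where
  "pseudo_hermitian_manifold m M \<longleftrightarrow>
     CARD('n) = 2 * m + 1 \<and> smooth_atlas (charts M) \<and> orientable (charts M) \<and>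
     cr_structure (charts M) m (H10 M) \<and>
     pseudo_hermitian_form (charts M) (H10 M) (form M) \<and>
     levi_nondegenerate (charts M) (H10 M) (form M) \<and>
     hermitian_fiber_metric (charts M) (H10 M) (hmetric M) \<and>
     is_reeb_field (charts M) (form M) (reeb M)"

definition H01 :: "('a, 'n::finite) pseudo_hermitian \<Rightarrow> 'a \<Rightarrow> 'a ctvec set" where
  "H01 M = cnj_bundle (H10 M)"

definition reeb_line :: "('a, 'n::finite) pseudo_hermitian \<Rightarrow> 'a \<Rightarrow> 'a ctvec set" where
  "reeb_line M p = range (\<lambda>c. vscale c (cplx_vec (reeb M p)))"

definition proj_hor :: "('a, 'n::finite) pseudo_hermitian \<Rightarrow> 'a \<Rightarrow> 'a tvec \<Rightarrow> 'a tvec" where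
  "proj_hor M p v = (THE u. u \<in> hor (H10 M) p \<and> (\<exists>c. v = u + vscale c (reeb M p)))"

definition proj_plus :: "('a, 'n::finite) pseudo_hermitian \<Rightarrow> 'a \<Rightarrow> 'a ctvec \<Rightarrow> 'a ctvec" where
  "proj_plus M p Z =
     (THE U. U \<in> H10 M p \<and> (\<exists>V\<in>H01 M p. \<exists>R\<in>reeb_line M p. Z = U + V + R))"

definition proj_minus :: "('a, 'n::finite) pseudo_hermitian \<Rightarrow> 'a \<Rightarrow> 'a ctvec \<Rightarrow> 'a ctvec" where
  "proj_minus M p Z =
     (THE V. V \<in> H01 M p \<and> (\<exists>U\<in>H10 M p. \<exists>R\<in>reeb_line M p. Z = U + V + R))"

(* pointwise action of a family of maps of tangent spaces on a vector field *)
definition on_fields :: "('a \<Rightarrow> 'v \<Rightarrow> 'w) \<Rightarrow> ('a \<Rightarrow> 'v) \<Rightarrow> 'a \<Rightarrow> 'w" where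
  "on_fields L X = (\<lambda>p. L p (X p))"

definition Jmap :: "('a, 'n::finite) pseudo_hermitian \<Rightarrow> 'a \<Rightarrow> 'a tvec \<Rightarrow> 'a tvec" where
  "Jmap M p v = Jb (H10 M) p (proj_hor M p v)"

definition htensor :: "('a, 'n::finite) pseudo_hermitian \<Rightarrow> 'a \<Rightarrow> 'a tvec \<Rightarrow> 'a tvec \<Rightarrow> real" where
  "htensor M p u v = hmetric M p (proj_hor M p u) (proj_hor M p v)"

definition gmetric :: "('a, 'n::finite) pseudo_hermitian \<Rightarrow> 'a \<Rightarrow> 'a tvec \<Rightarrow> 'a tvec \<Rightarrow> real" where
  "gmetric M p u v = htensor M p u v + form M p u * form M p v"

definition pseudo_kaehler_form ::
  "('a, 'n::finite) pseudo_hermitian \<Rightarrow> 'a \<Rightarrow> 'a tvec \<Rightarrow> 'a tvec \<Rightarrow> real" where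
  "pseudo_kaehler_form M p u v = gmetric M p (Jmap M p u) v"

definition pseudo_kaehler_type :: "('a, 'n::finite) pseudo_hermitian \<Rightarrow> bool" where
  "pseudo_kaehler_type M \<longleftrightarrow>
     (\<forall>X\<in>vfields (charts M). \<forall>Y\<in>vfields (charts M). \<forall>Z\<in>vfields (charts M). \<forall>p.
        ext_d2 (pseudo_kaehler_form M) X Y Z p = 0)"

section \<open>Pseudo-Hermitian connections\<close>

type_synonym 'a connection = "'a vfield \<Rightarrow> 'a vfield \<Rightarrow> 'a vfield"

definition linear_connection :: "('a, 'n::finite) chart set \<Rightarrow> 'a connection \<Rightarrow> bool" where
  "linear_connection A D \<longleftrightarrow>
     (\<forall>X\<in>vfields A. \<forall>Y\<in>vfields A. D X Y \<in> vfields A) \<and>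
     (\<forall>X\<in>vfields A. \<forall>X'\<in>vfields A. \<forall>Y\<in>vfields A. D (X + X') Y = D X Y + D X' Y) \<and>
     (\<forall>f\<in>smooth_funs A. \<forall>X\<in>vfields A. \<forall>Y\<in>vfields A. D (fscale f X) Y = fscale f (D X Y)) \<and>
     (\<forall>X\<in>vfields A. \<forall>Y\<in>vfields A. \<forall>Y'\<in>vfields A. D X (Y + Y') = D X Y + D X Y') \<and>
     (\<forall>f\<in>smooth_funs A. \<forall>X\<in>vfields A. \<forall>Y\<in>vfields A.
        D X (fscale f Y) = fscale (\<lambda>p. X p f) Y + fscale f (D X Y))"

definition preserves_bundle ::
  "('a, 'n::finite) chart set \<Rightarrow> 'a connection \<Rightarrow> ('a \<Rightarrow> 'a ctvec set) \<Rightarrow> bool" where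
  "preserves_bundle A D E \<longleftrightarrow>
     (\<forall>X\<in>cvfields A. \<forall>Z\<in>csections A E. cbilin D X Z \<in> csections A E)"

definition metric_connection ::
  "('a, 'n::finite) chart set \<Rightarrow> 'a connection \<Rightarrow> ('a \<Rightarrow> 'a tvec \<Rightarrow> 'a tvec \<Rightarrow> real) \<Rightarrow> bool" where
  "metric_connection A D g \<longleftrightarrow>
     (\<forall>X\<in>vfields A. \<forall>Y\<in>vfields A. \<forall>Z\<in>vfields A. \<forall>p.
        X p (\<lambda>q. g q (Y q) (Z q)) = g p (D X Y p) (Z p) + g p (Y p) (D X Z p))"

(* preserves_bundle refers to the complex bilinear extension of the connection. *)
definition pseudo_hermitian_connection ::
  "('a, 'n::finite) pseudo_hermitian \<Rightarrow> 'a connection \<Rightarrow> bool" where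
  "pseudo_hermitian_connection M D \<longleftrightarrow> linear_connection (charts M) D \<and>
     preserves_bundle (charts M) D (H10 M) \<and>
     preserves_bundle (charts M) D (H01 M) \<and>
     preserves_bundle (charts M) D (reeb_line M) \<and>
     metric_connection (charts M) D (gmetric M)"

definition torsion :: "'a connection \<Rightarrow> 'a vfield \<Rightarrow> 'a vfield \<Rightarrow> 'a vfield" where
  "torsion D X Y = D X Y - D Y X - lie_bracket X Y"

definition Theta :: "('a, 'n::finite) pseudo_hermitian \<Rightarrow> 'a connection \<Rightarrow>
    'a cvfield \<Rightarrow> 'a cvfield \<Rightarrow> 'a cvfield" where
  "Theta M D Z W = on_fields (proj_plus M) (cbilin (torsion D) Z W)"

definition Theta20 :: "('a, 'n::finite) pseudo_hermitian \<Rightarrow> 'a connection \<Rightarrow>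
    'a cvfield \<Rightarrow> 'a cvfield \<Rightarrow> 'a cvfield" where
  "Theta20 M D Z W = Theta M D (on_fields (proj_plus M) Z) (on_fields (proj_plus M) W)"

definition Theta11 :: "('a, 'n::finite) pseudo_hermitian \<Rightarrow> 'a connection \<Rightarrow>
    'a cvfield \<Rightarrow> 'a cvfield \<Rightarrow> 'a cvfield" where
  "Theta11 M D Z W =
     Theta M D (on_fields (proj_plus M) Z) (on_fields (proj_minus M) W) +
     Theta M D (on_fields (proj_minus M) Z) (on_fields (proj_plus M) W)"

definition tor_tau :: "('a, 'n::finite) pseudo_hermitian \<Rightarrow> 'a connection \<Rightarrow> 'a vfield \<Rightarrow> 'a vfield" where
  "tor_tau M D X = torsion D (reeb M) X"

definition tor_sigma :: "('a, 'n::finite) pseudo_hermitian \<Rightarrow> 'a connection \<Rightarrow> 'a vfield \<Rightarrow> 'a vfield" where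
  "tor_sigma M D X = tor_tau M D (on_fields (Jmap M) X) + on_fields (Jmap M) (tor_tau M D X)"

definition canonical_connection ::
  "('a, 'n::finite) pseudo_hermitian \<Rightarrow> 'a connection \<Rightarrow> bool" where
  "canonical_connection M D \<longleftrightarrow> pseudo_hermitian_connection M D \<and>
     (\<forall>Z\<in>cvfields (charts M). \<forall>W\<in>cvfields (charts M). Theta11 M D Z W = 0) \<and>
     (\<forall>X\<in>vfields (charts M). \<forall>Y\<in>vfields (charts M). \<forall>p.
        htensor M p (tor_sigma M D X p) (Y p) = - htensor M p (X p) (tor_sigma M D Y p))"

definition symmetric_wrt :: "('a, 'n::finite) chart set \<Rightarrow> ('a \<Rightarrow> 'a tvec \<Rightarrow> 'a tvec \<Rightarrow> real) \<Rightarrow>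
    ('a vfield \<Rightarrow> 'a vfield) \<Rightarrow> bool" where
  "symmetric_wrt A g L \<longleftrightarrow> (\<forall>X\<in>vfields A. \<forall>Y\<in>vfields A. \<forall>p.
     g p (L X p) (Y p) = g p (X p) (L Y p))"

end

theory Submission
  imports Defs
begin

text \<open>
  The connection \<open>D\<close> preserves \<open>J\<close> and the metric, hence the form \<open>\<Omega>\<close>, and therefore
  \<open>3 d\<Omega>(X,Y,Z)\<close> is the cyclic sum of \<open>\<Omega>(T(X,Y),Z)\<close>, where \<open>T\<close> is the torsion
  (\<open>ext_d2_torsion\<close>). The theorem is obtained by testing this sum on the splitting of the tangent
  bundle into the horizontal bundle and the Reeb line.

  For horizontal \<open>X\<close>, \<open>Y\<close>, \<open>Z\<close>, the vanishing of \<open>\<Theta>\<close> in type (1,1) together with the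
  integrability of the CR structure makes the horizontal part of \<open>T(X,Y)\<close> complex bilinear
  (\<open>torsion_J_J\<close>, \<open>torsion_J_left\<close>). Replacing \<open>X\<close>, \<open>Y\<close> by \<open>JX\<close>, \<open>JY\<close> then changes the sign of
  \<open>\<Omega>(T(X,Y),Z)\<close> and leaves the other two terms alone. So if the cyclic sum vanishes identically,
  every single term does, and \<open>Z = J T(X,Y)\<close> shows that the horizontal part of \<open>T(X,Y)\<close> is 0
  (\<open>kaehler_imp_torsion_free\<close>). This is the condition that \<open>\<Theta>\<close> vanishes in type (2,0)
  (\<open>Theta20_zero_iff\<close>).

  With the Reeb field as one argument, \<open>d\<Omega> = 0\<close> says that \<open>\<Omega>(\<tau>X,Y)\<close> is symmetric in \<open>X\<close>, \<open>Y\<close>.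
  This makes \<open>\<sigma>\<close> self-adjoint. For the canonical connection \<open>\<sigma>\<close> is also skew, so it vanishes, and
  once \<open>\<tau>\<close> anticommutes with \<open>J\<close> the symmetry of \<open>\<Omega>(\<tau>X,Y)\<close> is the symmetry of \<open>\<tau>\<close>
  (\<open>kaehler_imp_sigma_tau\<close>).

  Conversely, the three conditions leave \<open>\<theta>(X) \<tau>Y - \<theta>(Y) \<tau>X\<close> as the horizontal part of \<open>T(X,Y)\<close>
  (\<open>torsion_decomposition\<close>), and the symmetry of \<open>\<Omega>(\<tau>X,Y)\<close> cancels the cyclic sum in pairs.

  The conditions on the connection speak of smooth global sections, so the argument depends on \<open>J\<close>
  mapping smooth fields to smooth fields. This is read off from local frames of the CR structure:
  the coefficients of a smooth field in a smooth frame are smooth (\<open>smooth_frame_coefficients\<close>,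
  \<open>Jb_smooth\<close>). With it, complex fields of type (1,0) are the fields \<open>X - iJX\<close> with \<open>X\<close> horizontal,
  and all remaining computations are real.
\<close>

section \<open>Calculus of smooth functions on normed spaces\<close>

lemma frechet_derivative_cong_open:
  assumes "open S" "x \<in> S" "\<And>y. y \<in> S \<Longrightarrow> f y = g y"
  shows "f differentiable (at x) \<longleftrightarrow> g differentiable (at x)"
    and "frechet_derivative f (at x) = frechet_derivative g (at x)"
proof -
  have "(f has_derivative D) (at x) \<longleftrightarrow> (g has_derivative D) (at x)" for D
  proof
    show "(f has_derivative D) (at x) \<Longrightarrow> (g has_derivative D) (at x)"
      by (rule has_derivative_transform_within_open[of f D x UNIV S]) (use assms in auto)
    show "(g has_derivative D) (at x) \<Longrightarrow> (f has_derivative D) (at x)"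
      by (rule has_derivative_transform_within_open[of g D x UNIV S]) (use assms in auto)
  qed
  then show "f differentiable (at x) \<longleftrightarrow> g differentiable (at x)"
    and "frechet_derivative f (at x) = frechet_derivative g (at x)"
    by (simp_all add: differentiable_def frechet_derivative_def)
qed

lemma Ck_on_cong:
  "open S \<Longrightarrow> (\<And>y. y \<in> S \<Longrightarrow> f y = g y) \<Longrightarrow> Ck_on k S f \<longleftrightarrow> Ck_on k S g"
proof (induction k arbitrary: f g)
  case 0
  then show ?case by (simp cong: continuous_on_cong)
next
  case (Suc k)
  have d: "f differentiable (at x) \<longleftrightarrow> g differentiable (at x)"
      "frechet_derivative f (at x) = frechet_derivative g (at x)" if "x \<in> S" for x
    by (rule frechet_derivative_cong_open[OF Suc.prems(1) that]; use Suc.prems(2) in blast)+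
  have "Ck_on k S (\<lambda>x. frechet_derivative f (at x) v) \<longleftrightarrow>
        Ck_on k S (\<lambda>x. frechet_derivative g (at x) v)" for v
    by (rule Suc.IH[OF Suc.prems(1)]) (simp add: d)
  then show ?case using d by auto
qed

lemma Ck_on_decrease: "Ck_on (Suc k) S f \<Longrightarrow> Ck_on k S f"
proof (induction k arbitrary: f)
  case 0
  then show ?case
    by (auto intro!: differentiable_imp_continuous_on differentiable_at_imp_differentiable_on)
qed auto

lemma Ck_on_subset: "Ck_on k S f \<Longrightarrow> T \<subseteq> S \<Longrightarrow> Ck_on k T f"
  by (induction k arbitrary: f) (auto intro: continuous_on_subset)

lemma Ck_on_local:
  assumes "\<And>x. x \<in> S \<Longrightarrow> \<exists>V. open V \<and> x \<in> V \<and> Ck_on k V f"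
  shows "Ck_on k S f"
  using assms
proof (induction k arbitrary: f)
  case 0
  then show ?case
    by (metis Ck_on.simps(1) continuous_at_imp_continuous_on continuous_on_eq_continuous_at)
next
  case (Suc k)
  show ?case
    unfolding Ck_on.simps
  proof (intro conjI ballI allI)
    show "f differentiable (at x)" if "x \<in> S" for x
      using Suc.prems[OF that] by auto
    show "Ck_on k S (\<lambda>x. frechet_derivative f (at x) v)" for v
      by (rule Suc.IH) (use Suc.prems in fastforce)
  qed
qed

lemma Ck_on_const: "Ck_on k S (\<lambda>x. c)"
  by (induction k arbitrary: c) (auto simp: frechet_derivative_const)

lemma Ck_on_SucD:
  "Ck_on (Suc k) S f \<Longrightarrow> x \<in> S \<Longrightarrow> (f has_derivative frechet_derivative f (at x)) (at x)"
  by (simp flip: frechet_derivative_works)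

lemma Ck_on_SucI:
  assumes S: "open S" and d: "\<And>x. x \<in> S \<Longrightarrow> (f has_derivative D x) (at x)"
    and "\<And>v. Ck_on k S (\<lambda>x. D x v)"
  shows "Ck_on (Suc k) S f"
proof -
  have "frechet_derivative f (at x) v = D x v" if "x \<in> S" for x v
    using frechet_derivative_at[OF d[OF that]] by simp
  then have "Ck_on k S (\<lambda>x. frechet_derivative f (at x) v) \<longleftrightarrow> Ck_on k S (\<lambda>x. D x v)" for v
    by (intro Ck_on_cong[OF S])
  then show ?thesis
    using d assms(3) by (auto simp: differentiable_def)
qed

lemma Ck_on_bounded_linear:
  assumes L: "bounded_linear L"
  shows "open S \<Longrightarrow> Ck_on k S f \<Longrightarrow> Ck_on k S (\<lambda>x. L (f x))"
proof (induction k arbitrary: f)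
  case 0
  then show ?case by (simp add: bounded_linear.continuous_on[OF L])
next
  case (Suc k)
  show ?case
  proof (rule Ck_on_SucI)
    show "((\<lambda>x. L (f x)) has_derivative (\<lambda>v. L (frechet_derivative f (at x) v))) (at x)"
      if "x \<in> S" for x
      by (rule bounded_linear.has_derivative[OF L Ck_on_SucD[OF Suc.prems(2) that]])
    show "Ck_on k S (\<lambda>x. L (frechet_derivative f (at x) v))" for v
      using Suc by auto
  qed fact
qed

lemma Ck_on_add:
  "open S \<Longrightarrow> Ck_on k S f \<Longrightarrow> Ck_on k S g \<Longrightarrow> Ck_on k S (\<lambda>x. f x + g x)"
proof (induction k arbitrary: f g)
  case 0
  then show ?case by (simp add: continuous_on_add)
next
  case (Suc k)
  show ?case
  proof (rule Ck_on_SucI)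
    show "((\<lambda>x. f x + g x) has_derivative
        (\<lambda>v. frechet_derivative f (at x) v + frechet_derivative g (at x) v)) (at x)"
      if "x \<in> S" for x
      by (intro has_derivative_add Ck_on_SucD[OF Suc.prems(2) that] Ck_on_SucD[OF Suc.prems(3) that])
    show "Ck_on k S (\<lambda>x. frechet_derivative f (at x) v + frechet_derivative g (at x) v)" for v
      using Suc by auto
  qed fact
qed

lemma Ck_on_mult:
  fixes f g :: "'s::real_normed_vector \<Rightarrow> 't::real_normed_algebra"
  shows "open S \<Longrightarrow> Ck_on k S f \<Longrightarrow> Ck_on k S g \<Longrightarrow> Ck_on k S (\<lambda>x. f x * g x)"
proof (induction k arbitrary: f g)
  case 0
  then show ?case by (simp add: continuous_on_mult)
next
  case (Suc k)
  show ?case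
  proof (rule Ck_on_SucI)
    show "((\<lambda>x. f x * g x) has_derivative
        (\<lambda>v. f x * frechet_derivative g (at x) v + frechet_derivative f (at x) v * g x)) (at x)"
      if "x \<in> S" for x
      by (intro has_derivative_mult Ck_on_SucD[OF Suc.prems(2) that] Ck_on_SucD[OF Suc.prems(3) that])
    have "Ck_on k S f" "Ck_on k S g"
      using Suc.prems Ck_on_decrease by blast+
    then show "Ck_on k S (\<lambda>x. f x * frechet_derivative g (at x) v + frechet_derivative f (at x) v * g x)"
      for v using Suc.prems by (intro Ck_on_add Suc.IH) auto
  qed fact
qed

lemma Ck_on_inverse:
  fixes f :: "'s::real_normed_vector \<Rightarrow> 't::real_normed_field"
  shows "open S \<Longrightarrow> Ck_on k S f \<Longrightarrow> (\<And>x. x \<in> S \<Longrightarrow> f x \<noteq> 0) \<Longrightarrow> Ck_on k S (\<lambda>x. inverse (f x))"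
proof (induction k)
  case 0
  then show ?case by (simp add: continuous_on_inverse)
next
  case (Suc k)
  show ?case
  proof (rule Ck_on_SucI)
    show "((\<lambda>x. inverse (f x)) has_derivative
        (\<lambda>v. - (inverse (f x) * frechet_derivative f (at x) v * inverse (f x)))) (at x)"
      if "x \<in> S" for x
      by (rule Deriv.has_derivative_inverse[OF Suc.prems(3)[OF that] Ck_on_SucD[OF Suc.prems(2) that]])
    have "Ck_on k S (\<lambda>x. inverse (f x))"
      using Suc Ck_on_decrease by blast
    then have "Ck_on k S (\<lambda>x. (-1) * (inverse (f x) * frechet_derivative f (at x) v * inverse (f x)))" for v
      using Suc.prems by (intro Ck_on_mult Ck_on_const) auto
    then show "Ck_on k S (\<lambda>x. - (inverse (f x) * frechet_derivative f (at x) v * inverse (f x)))" for v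
      by simp
  qed fact
qed

section \<open>Smooth functions on a manifold\<close>

lemma open_chart_image:
  assumes "is_chart (U, \<phi>)" "open V"
  shows "open (\<phi> ` (U \<inter> V))"
proof -
  obtain \<psi> where U: "open U" "open (\<phi> ` U)" and h: "homeomorphism U (\<phi> ` U) \<phi> \<psi>"
    using assms(1) by (auto simp: is_chart_def)
  have "\<phi> ` (U \<inter> V) = \<phi> ` U \<inter> \<psi> -` V"
    by (auto simp: homeomorphism_apply1[OF h])
  moreover have "open (\<phi> ` U \<inter> \<psi> -` V)"
    by (rule continuous_open_preimage[OF homeomorphism_cont2[OF h] U(2) assms(2)])
  ultimately show ?thesis by simp
qed

lemma chart_inj:
  assumes "is_chart (U, \<phi>)" shows "inj_on \<phi> U"
proof -
  obtain \<psi> where "homeomorphism U (\<phi> ` U) \<phi> \<psi>"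
    using assms by (auto simp: is_chart_def)
  then show ?thesis by (intro inj_on_inverseI[of U \<psi>]) (rule homeomorphism_apply1)
qed

text \<open>Smoothness of the germ at \<open>p\<close>. In contrast to smoothness on a given set it is stable under
  division by a function that does not vanish at \<open>p\<close>, which the elimination argument for frame
  coefficients relies on.\<close>

definition smooth_near ::
  "('a::topological_space, 'n::finite) chart set \<Rightarrow> 'a \<Rightarrow> ('a \<Rightarrow> 'b::real_normed_vector) \<Rightarrow> bool" where
  "smooth_near A p u \<longleftrightarrow> (\<exists>V. open V \<and> p \<in> V \<and> smooth_fun_on A V u)"

locale atlas =
  fixes A :: "('a::topological_space, 'n::finite) chart set"
  assumes smooth_atlas: "smooth_atlas A"
begin

lemma charts_are_charts: "(U, \<phi>) \<in> A \<Longrightarrow> is_chart (U, \<phi>)"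
  using smooth_atlas unfolding smooth_atlas_def by blast

lemma ex_chart: "\<exists>U \<phi>. (U, \<phi>) \<in> A \<and> p \<in> U"
proof -
  have "p \<in> (\<Union>c\<in>A. fst c)" using smooth_atlas by (simp add: smooth_atlas_def)
  then obtain c where "c \<in> A" "p \<in> fst c" by blast
  then show ?thesis by (metis prod.collapse)
qed

lemma smooth_fun_on_iff:
  "smooth_fun_on A S f \<longleftrightarrow>
    (\<forall>U \<phi> k. (U, \<phi>) \<in> A \<longrightarrow> Ck_on k (\<phi> ` (U \<inter> S)) (\<lambda>x. f (inv_into U \<phi> x)))"
  unfolding smooth_fun_on_def Cinf_on_def o_def by blast

lemma smooth_fun_onI:
  assumes "\<And>U \<phi> k. (U, \<phi>) \<in> A \<Longrightarrow> open (\<phi> ` (U \<inter> S)) \<Longrightarrow> Ck_on k (\<phi> ` (U \<inter> S)) (\<lambda>x. f (inv_into U \<phi> x))"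
    and "open S"
  shows "smooth_fun_on A S f"
  unfolding smooth_fun_on_iff
proof (intro allI impI)
  show "Ck_on k (\<phi> ` (U \<inter> S)) (\<lambda>x. f (inv_into U \<phi> x))" if "(U, \<phi>) \<in> A" for U \<phi> k
    by (rule assms(1)[OF that open_chart_image[OF charts_are_charts[OF that] assms(2)]])
qed

lemma smooth_fun_onD:
  "smooth_fun_on A S f \<Longrightarrow> (U, \<phi>) \<in> A \<Longrightarrow> Ck_on k (\<phi> ` (U \<inter> S)) (\<lambda>x. f (inv_into U \<phi> x))"
  unfolding smooth_fun_on_iff by blast

lemma smooth_fun_on_subset:
  assumes "smooth_fun_on A S f" "T \<subseteq> S" shows "smooth_fun_on A T f"
  unfolding smooth_fun_on_iff
proof (intro allI impI)
  show "Ck_on k (\<phi> ` (U \<inter> T)) (\<lambda>x. f (inv_into U \<phi> x))" if "(U, \<phi>) \<in> A" for U \<phi> k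
    using smooth_fun_onD[OF assms(1) that] by (rule Ck_on_subset) (use assms(2) in blast)
qed

lemma smooth_fun_on_cong:
  assumes "open S" "\<And>q. q \<in> S \<Longrightarrow> f q = g q" "smooth_fun_on A S f"
  shows "smooth_fun_on A S g"
proof (rule smooth_fun_onI)
  fix U \<phi> k assume U: "(U, \<phi>) \<in> A" and o: "open (\<phi> ` (U \<inter> S))"
  have "f (inv_into U \<phi> y) = g (inv_into U \<phi> y)" if "y \<in> \<phi> ` (U \<inter> S)" for y
    using that assms(2) inv_into_f_f[OF chart_inj[OF charts_are_charts[OF U]]] by force
  then show "Ck_on k (\<phi> ` (U \<inter> S)) (\<lambda>x. g (inv_into U \<phi> x))"
    using Ck_on_cong[OF o] smooth_fun_onD[OF assms(3) U, of k] by metis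
qed fact

lemma smooth_fun_on_local:
  assumes "\<And>p. p \<in> S \<Longrightarrow> smooth_near A p f"
  shows "smooth_fun_on A S f"
  unfolding smooth_fun_on_iff
proof (intro allI impI)
  fix U \<phi> k assume U: "(U, \<phi>) \<in> A"
  show "Ck_on k (\<phi> ` (U \<inter> S)) (\<lambda>x. f (inv_into U \<phi> x))"
  proof (rule Ck_on_local)
    fix x assume "x \<in> \<phi> ` (U \<inter> S)"
    then obtain p where p: "p \<in> U" "p \<in> S" "x = \<phi> p" by auto
    obtain V where V: "open V" "p \<in> V" "smooth_fun_on A V f"
      using assms[OF p(2)] by (auto simp: smooth_near_def)
    show "\<exists>W. open W \<and> x \<in> W \<and> Ck_on k W (\<lambda>x. f (inv_into U \<phi> x))"
      using open_chart_image[OF charts_are_charts[OF U] V(1)] smooth_fun_onD[OF V(3) U] p V(2)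
      by blast
  qed
qed

lemma smooth_nearI: "smooth_fun_on A V f \<Longrightarrow> open V \<Longrightarrow> p \<in> V \<Longrightarrow> smooth_near A p f"
  by (auto simp: smooth_near_def)

lemma smooth_on_UNIV_iff: "smooth_fun_on A UNIV f \<longleftrightarrow> (\<forall>p. smooth_near A p f)"
  using smooth_fun_on_local[of UNIV f] smooth_nearI[of UNIV f] by auto

lemma smooth_near_unop:
  assumes "smooth_near A p f"
    and "\<And>V. open V \<Longrightarrow> smooth_fun_on A V f \<Longrightarrow> smooth_fun_on A V g"
  shows "smooth_near A p g"
  using assms by (auto simp: smooth_near_def)

lemma smooth_near_binop:
  assumes "smooth_near A p f" "smooth_near A p g"
    and "\<And>V. open V \<Longrightarrow> smooth_fun_on A V f \<Longrightarrow> smooth_fun_on A V g \<Longrightarrow> smooth_fun_on A V k"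
  shows "smooth_near A p k"
proof -
  obtain V W where VW: "open V" "p \<in> V" "smooth_fun_on A V f" "open W" "p \<in> W" "smooth_fun_on A W g"
    using assms(1,2) by (auto simp: smooth_near_def)
  then have "smooth_fun_on A (V \<inter> W) k"
    by (intro assms(3) open_Int smooth_fun_on_subset[OF VW(3)] smooth_fun_on_subset[OF VW(6)]) auto
  then show ?thesis
    by (rule smooth_nearI) (use VW in auto)
qed

lemma smooth_near_const: "smooth_near A p (\<lambda>q. c)"
  by (rule smooth_nearI[of UNIV]) (auto intro!: smooth_fun_onI Ck_on_const)

lemma smooth_near_linear: "bounded_linear L \<Longrightarrow> smooth_near A p f \<Longrightarrow> smooth_near A p (\<lambda>q. L (f q))"
  by (rule smooth_near_unop[of p f], assumption, rule smooth_fun_onI)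
    (rule Ck_on_bounded_linear[of L], assumption+, erule (1) smooth_fun_onD)

lemma smooth_near_add:
  "smooth_near A p f \<Longrightarrow> smooth_near A p g \<Longrightarrow> smooth_near A p (\<lambda>q. f q + g q)"
  by (rule smooth_near_binop[of p f g], assumption+, rule smooth_fun_onI)
    (rule Ck_on_add, assumption, erule (1) smooth_fun_onD, erule (1) smooth_fun_onD)

lemma smooth_near_mult:
  fixes f :: "'a \<Rightarrow> 'b::real_normed_algebra"
  shows "smooth_near A p f \<Longrightarrow> smooth_near A p g \<Longrightarrow> smooth_near A p (\<lambda>q. f q * g q)"
  by (rule smooth_near_binop[of p f g], assumption+, rule smooth_fun_onI)
    (rule Ck_on_mult, assumption, erule (1) smooth_fun_onD, erule (1) smooth_fun_onD)

lemma smooth_near_uminus: "smooth_near A p f \<Longrightarrow> smooth_near A p (\<lambda>q. - f q)"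
  by (rule smooth_near_linear[OF bounded_linear_minus[OF bounded_linear_ident]])

lemma smooth_near_diff:
  "smooth_near A p f \<Longrightarrow> smooth_near A p g \<Longrightarrow> smooth_near A p (\<lambda>q. f q - g q)"
  using smooth_near_add[OF _ smooth_near_uminus, of p f g] by simp

lemma smooth_near_sum:
  "(\<And>i. i \<in> I \<Longrightarrow> smooth_near A p (f i)) \<Longrightarrow> smooth_near A p (\<lambda>q. \<Sum>i\<in>I. f i q)"
  by (induction I rule: infinite_finite_induct) (auto intro: smooth_near_add smooth_near_const)

lemma smooth_near_cong:
  assumes "smooth_near A p f" "open V" "p \<in> V" "\<And>q. q \<in> V \<Longrightarrow> f q = g q"
  shows "smooth_near A p g"
proof -
  obtain W where W: "open W" "p \<in> W" "smooth_fun_on A W f"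
    using assms(1) by (auto simp: smooth_near_def)
  then have "smooth_fun_on A (V \<inter> W) g"
    using assms by (intro smooth_fun_on_cong[OF _ _ smooth_fun_on_subset[OF W(3)]]) auto
  then show ?thesis
    by (rule smooth_nearI) (use assms W in auto)
qed

lemma nonzero_near:
  fixes f :: "'a \<Rightarrow> 'b::real_normed_vector"
  assumes "smooth_near A p f" "f p \<noteq> 0"
  shows "\<exists>V. open V \<and> p \<in> V \<and> (\<forall>q\<in>V. f q \<noteq> 0)"
proof -
  obtain V where V: "open V" "p \<in> V" "smooth_fun_on A V f"
    using assms by (auto simp: smooth_near_def)
  obtain U \<phi> where U: "(U, \<phi>) \<in> A" "p \<in> U" using ex_chart by blast
  note c = charts_are_charts[OF U(1)]
  have "continuous_on (\<phi> ` (U \<inter> V)) (\<lambda>x. f (inv_into U \<phi> x))"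
    using smooth_fun_onD[OF V(3) U(1), of 0] by simp
  moreover have "continuous_on (U \<inter> V) \<phi>"
    using c by (auto simp: is_chart_def homeomorphism_def intro: continuous_on_subset)
  ultimately have "continuous_on (U \<inter> V) (\<lambda>q. f (inv_into U \<phi> (\<phi> q)))"
    by (rule continuous_on_compose2) auto
  then have "continuous_on (U \<inter> V) f"
    by (rule continuous_on_eq) (simp add: inv_into_f_f[OF chart_inj[OF c]])
  moreover have "open (U \<inter> V)" using V c by (auto simp: is_chart_def)
  ultimately have "open (f -` (- {0}) \<inter> (U \<inter> V))"
    using continuous_on_open_vimage by blast
  then show ?thesis
    using U V assms(2) by (intro exI[of _ "f -` (- {0}) \<inter> (U \<inter> V)"]) auto
qed

lemma smooth_near_inverse:
  fixes f :: "'a \<Rightarrow> 'b::real_normed_field"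
  assumes "smooth_near A p f" "f p \<noteq> 0"
  shows "smooth_near A p (\<lambda>q. inverse (f q))"
proof -
  obtain V where V: "open V" "p \<in> V" "\<forall>q\<in>V. f q \<noteq> 0" using nonzero_near[OF assms] by auto
  obtain W where W: "open W" "p \<in> W" "smooth_fun_on A W f"
    using assms(1) by (auto simp: smooth_near_def)
  have "smooth_fun_on A (V \<inter> W) (\<lambda>q. inverse (f q))"
  proof (rule smooth_fun_onI)
    fix U \<phi> k assume U: "(U, \<phi>) \<in> A" and o: "open (\<phi> ` (U \<inter> (V \<inter> W)))"
    have "Ck_on k (\<phi> ` (U \<inter> (V \<inter> W))) (\<lambda>x. f (inv_into U \<phi> x))"
      by (rule Ck_on_subset[OF smooth_fun_onD[OF W(3) U]]) auto
    then show "Ck_on k (\<phi> ` (U \<inter> (V \<inter> W))) (\<lambda>x. inverse (f (inv_into U \<phi> x)))"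
      using V o by (intro Ck_on_inverse)
        (auto simp: inv_into_f_f[OF chart_inj[OF charts_are_charts[OF U]]])
  qed (use V W in auto)
  then show ?thesis by (rule smooth_nearI) (use V W in auto)
qed

lemma smooth_near_divide:
  fixes f :: "'a \<Rightarrow> 'b::real_normed_field"
  assumes "smooth_near A p f" "smooth_near A p g" "g p \<noteq> 0"
  shows "smooth_near A p (\<lambda>q. f q / g q)"
  using smooth_near_mult[OF assms(1) smooth_near_inverse[OF assms(2,3)]]
  by (simp add: divide_inverse)

lemma smooth_near_Complex:
  assumes "smooth_near A p f" "smooth_near A p g"
  shows "smooth_near A p (\<lambda>q. Complex (f q) (g q))"
proof -
  have "smooth_near A p (\<lambda>q. complex_of_real (f q) + \<i> * complex_of_real (g q))"
    by (intro smooth_near_add smooth_near_mult smooth_near_const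
        smooth_near_linear[OF bounded_linear_of_real] assms)
  then show ?thesis by (simp add: Complex_eq)
qed

end

section \<open>Tangent vectors and vector fields\<close>

lemma vscale_apply: "vscale c v f = c * v f"
  by (simp add: vscale_def)

lemma fscale_apply: "fscale u X p = vscale (u p) (X p)"
  by (simp add: fscale_def)

lemma sum_fun_apply: "(\<Sum>i\<in>I. v i) f = (\<Sum>i\<in>I. v i f)"
  for v :: "'i \<Rightarrow> 'b \<Rightarrow> 'c::comm_monoid_add"
  by (induction I rule: infinite_finite_induct) auto

context atlas
begin

lemma smooth_funs_iff: "f \<in> smooth_funs A \<longleftrightarrow> (\<forall>p. smooth_near A p f)"
  by (simp add: smooth_funs_def smooth_on_UNIV_iff)

lemma smooth_funs_const: "(\<lambda>q. c) \<in> smooth_funs A"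
  by (simp add: smooth_funs_iff smooth_near_const)

lemma smooth_funs_add:
  "f \<in> smooth_funs A \<Longrightarrow> g \<in> smooth_funs A \<Longrightarrow> (\<lambda>q. f q + g q) \<in> smooth_funs A"
  by (simp add: smooth_funs_iff smooth_near_add)

lemma smooth_funs_mult:
  "f \<in> smooth_funs A \<Longrightarrow> g \<in> smooth_funs A \<Longrightarrow> (\<lambda>q. f q * g q) \<in> smooth_funs A"
  by (simp add: smooth_funs_iff smooth_near_mult)

lemma smooth_funs_diff:
  "f \<in> smooth_funs A \<Longrightarrow> g \<in> smooth_funs A \<Longrightarrow> (\<lambda>q. f q - g q) \<in> smooth_funs A"
  by (simp add: smooth_funs_iff smooth_near_diff)

lemma smooth_funs_uminus: "f \<in> smooth_funs A \<Longrightarrow> (\<lambda>q. - f q) \<in> smooth_funs A"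
  by (simp add: smooth_funs_iff smooth_near_uminus)

lemma tangent_add:
  "v \<in> tangent_space A p \<Longrightarrow> f \<in> smooth_funs A \<Longrightarrow> g \<in> smooth_funs A \<Longrightarrow>
    v (\<lambda>q. f q + g q) = v f + v g"
  by (simp add: tangent_space_def plus_fun_def)

lemma tangent_scale:
  "v \<in> tangent_space A p \<Longrightarrow> f \<in> smooth_funs A \<Longrightarrow> v (\<lambda>q. c * f q) = c * v f"
  by (simp add: tangent_space_def)

lemma tangent_mult:
  "v \<in> tangent_space A p \<Longrightarrow> f \<in> smooth_funs A \<Longrightarrow> g \<in> smooth_funs A \<Longrightarrow>
    v (\<lambda>q. f q * g q) = f p * v g + g p * v f"
  by (simp add: tangent_space_def times_fun_def)

lemma tangent_nonsmooth: "v \<in> tangent_space A p \<Longrightarrow> f \<notin> smooth_funs A \<Longrightarrow> v f = 0"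
  by (simp add: tangent_space_def)

lemma tangent_const:
  assumes "v \<in> tangent_space A p" shows "v (\<lambda>q. c) = 0"
proof -
  have "v (\<lambda>q. 1 * 1) = 1 * v (\<lambda>q. 1) + 1 * v (\<lambda>q. 1)"
    by (rule tangent_mult[OF assms smooth_funs_const smooth_funs_const])
  then have "v (\<lambda>q. 1) = 0" by simp
  then show ?thesis
    using tangent_scale[OF assms smooth_funs_const[of 1], of c] by simp
qed

lemma tangent_space_add:
  "v \<in> tangent_space A p \<Longrightarrow> w \<in> tangent_space A p \<Longrightarrow> v + w \<in> tangent_space A p"
  by (auto simp: tangent_space_def algebra_simps)

lemma tangent_space_vscale: "v \<in> tangent_space A p \<Longrightarrow> vscale c v \<in> tangent_space A p"
  by (auto simp: tangent_space_def vscale_def algebra_simps)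

lemma tangent_space_zero: "0 \<in> tangent_space A p"
  by (auto simp: tangent_space_def)

lemma tangent_space_uminus: "v \<in> tangent_space A p \<Longrightarrow> - v \<in> tangent_space A p"
  by (auto simp: tangent_space_def algebra_simps)

lemma tangent_space_diff:
  "v \<in> tangent_space A p \<Longrightarrow> w \<in> tangent_space A p \<Longrightarrow> v - w \<in> tangent_space A p"
  using tangent_space_add[OF _ tangent_space_uminus, of v p w] by simp

lemmas tangent_space_intros =
  tangent_space_zero tangent_space_add tangent_space_vscale tangent_space_uminus tangent_space_diff

lemma vfield_tangent: "X \<in> vfields A \<Longrightarrow> X p \<in> tangent_space A p"
  by (simp add: vfields_on_def)

text \<open>A tangent vector takes the value 0 on functions that are not smooth, so \<open>X f\<close> is smooth
  for every \<open>f\<close>.\<close>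

lemma vfield_apply_smooth:
  assumes "X \<in> vfields A" shows "(\<lambda>q. X q f) \<in> smooth_funs A"
proof (cases "f \<in> smooth_funs A")
  case True
  then show ?thesis using assms by (simp add: vfields_on_def smooth_funs_def)
next
  case False
  then have "(\<lambda>q. X q f) = (\<lambda>q. 0)"
    using tangent_nonsmooth[OF vfield_tangent[OF assms]] by blast
  then show ?thesis by (simp add: smooth_funs_const)
qed

lemma vfieldsI:
  assumes "\<And>p. X p \<in> tangent_space A p"
    and "\<And>f. f \<in> smooth_funs A \<Longrightarrow> (\<lambda>q. X q f) \<in> smooth_funs A"
  shows "X \<in> vfields A"
  using assms by (simp add: vfields_on_def smooth_funs_def)

lemma vfields_zero: "0 \<in> vfields A"
  by (rule vfieldsI) (simp_all add: tangent_space_zero smooth_funs_const)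

lemma vfields_add: "X \<in> vfields A \<Longrightarrow> Y \<in> vfields A \<Longrightarrow> X + Y \<in> vfields A"
  by (rule vfieldsI)
    (simp_all add: tangent_space_add vfield_tangent smooth_funs_add vfield_apply_smooth)

lemma vfields_uminus: "X \<in> vfields A \<Longrightarrow> - X \<in> vfields A"
  by (rule vfieldsI)
    (simp_all add: tangent_space_uminus vfield_tangent smooth_funs_uminus vfield_apply_smooth)

lemma vfields_diff: "X \<in> vfields A \<Longrightarrow> Y \<in> vfields A \<Longrightarrow> X - Y \<in> vfields A"
  by (rule vfieldsI)
    (simp_all add: tangent_space_diff vfield_tangent smooth_funs_diff vfield_apply_smooth)

lemma vfields_fscale: "u \<in> smooth_funs A \<Longrightarrow> X \<in> vfields A \<Longrightarrow> fscale u X \<in> vfields A"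
  by (rule vfieldsI)
    (simp_all add: fscale_apply vscale_apply tangent_space_vscale vfield_tangent smooth_funs_mult
      vfield_apply_smooth)

lemma vfields_lie_bracket:
  assumes X: "X \<in> vfields A" and Y: "Y \<in> vfields A"
  shows "lie_bracket X Y \<in> vfields A"
proof (rule vfieldsI)
  fix p
  note s = vfield_apply_smooth[OF X] vfield_apply_smooth[OF Y]
  note Xp = vfield_tangent[OF X] and Yp = vfield_tangent[OF Y]
  show "lie_bracket X Y p \<in> tangent_space A p"
    unfolding tangent_space_def
  proof (intro CollectI conjI ballI allI impI)
    fix f g assume fg: "f \<in> smooth_funs A" "g \<in> smooth_funs A"
    show "lie_bracket X Y p (f + g) = lie_bracket X Y p f + lie_bracket X Y p g"
      by (simp add: lie_bracket_def plus_fun_def tangent_add[OF Xp] tangent_add[OF Yp] fg s)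
    show "lie_bracket X Y p (f * g) = f p * lie_bracket X Y p g + g p * lie_bracket X Y p f"
      by (simp add: lie_bracket_def times_fun_def tangent_mult[OF Xp] tangent_mult[OF Yp]
          tangent_add[OF Xp] tangent_add[OF Yp] fg s smooth_funs_mult algebra_simps)
  next
    fix c f assume f: "f \<in> smooth_funs A"
    show "lie_bracket X Y p (\<lambda>q. c * f q) = c * lie_bracket X Y p f"
      by (simp add: lie_bracket_def tangent_scale[OF Xp] tangent_scale[OF Yp] f s algebra_simps)
  next
    fix f assume "f \<notin> smooth_funs A"
    then show "lie_bracket X Y p f = 0"
      by (simp add: lie_bracket_def tangent_nonsmooth[OF Xp] tangent_nonsmooth[OF Yp]
          tangent_const[OF Xp] tangent_const[OF Yp])
  qed
  fix f
  show "(\<lambda>q. lie_bracket X Y q f) \<in> smooth_funs A"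
    unfolding lie_bracket_def
    by (intro smooth_funs_diff vfield_apply_smooth X Y)
qed

lemma lie_bracket_add_left:
  assumes "X \<in> vfields A" "X' \<in> vfields A" "Y \<in> vfields A"
  shows "lie_bracket (X + X') Y = lie_bracket X Y + lie_bracket X' Y"
  by (simp add: fun_eq_iff lie_bracket_def tangent_add[OF vfield_tangent[OF assms(3)]]
      vfield_apply_smooth assms)

lemma lie_bracket_fscale_left:
  assumes "u \<in> smooth_funs A" "X \<in> vfields A" "Y \<in> vfields A"
  shows "lie_bracket (fscale u X) Y = fscale u (lie_bracket X Y) - fscale (\<lambda>p. Y p u) X"
  by (simp add: fun_eq_iff lie_bracket_def fscale_def vscale_def
      tangent_mult[OF vfield_tangent[OF assms(3)]] vfield_apply_smooth assms algebra_simps)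

lemma lie_bracket_flip: "lie_bracket X Y = - lie_bracket Y X"
  by (simp add: fun_eq_iff lie_bracket_def)

end

section \<open>Smooth dependence of frame coefficients\<close>

context atlas
begin

text \<open>Gaussian elimination: independence at \<open>p\<close> provides an argument \<open>f0\<close> at which the last frame
  element does not vanish near \<open>p\<close>. Subtracting multiples of that element from the other ones and
  from \<open>w\<close> makes them all vanish at \<open>f0\<close> and leaves a frame of length \<open>k\<close> with the same remaining
  coefficients. Evaluation at \<open>f0\<close> then yields the last coefficient.\<close>

lemma smooth_frame_coefficients:
  fixes v :: "nat \<Rightarrow> 'a \<Rightarrow> 'b \<Rightarrow> 'k::real_normed_field"
  assumes "\<And>j f. j < k \<Longrightarrow> smooth_near A p (\<lambda>q. v j q f)"
    and "\<And>f. smooth_near A p (\<lambda>q. w q f)"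
    and "\<And>a. (\<And>f. (\<Sum>j<k. a j * v j p f) = 0) \<Longrightarrow> \<forall>j<k. a j = 0"
    and "open V" "p \<in> V"
    and "\<And>q f. q \<in> V \<Longrightarrow> w q f = (\<Sum>j<k. c j q * v j q f)"
  shows "\<forall>j<k. smooth_near A p (c j)"
  using assms
proof (induction k arbitrary: v w V)
  case 0
  then show ?case by simp
next
  case (Suc k)
  have "\<exists>f. v k p f \<noteq> 0"
  proof (rule ccontr)
    assume "\<not> ?thesis"
    then have "(\<Sum>j<Suc k. (if j = k then 1 else 0) * v j p f) = 0" for f
      by simp
    from Suc.prems(3)[OF this] show False by auto
  qed
  then obtain f0 where f0: "v k p f0 \<noteq> 0" by auto
  obtain W where W: "open W" "p \<in> W" "\<And>q. q \<in> W \<Longrightarrow> v k q f0 \<noteq> 0"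
    using nonzero_near[OF Suc.prems(1)[of k f0]] f0 by auto
  define v' where "v' j q f = v j q f - (v j q f0 / v k q f0) * v k q f" for j q f
  define w' where "w' q f = w q f - (w q f0 / v k q f0) * v k q f" for q f
  have c: "\<forall>j<k. smooth_near A p (c j)"
  proof (rule Suc.IH)
    show "smooth_near A p (\<lambda>q. v' j q f)" if "j < k" for j f
      unfolding v'_def using that f0
      by (intro smooth_near_diff smooth_near_mult smooth_near_divide Suc.prems(1)) auto
    show "smooth_near A p (\<lambda>q. w' q f)" for f
      unfolding w'_def using f0
      by (intro smooth_near_diff smooth_near_mult smooth_near_divide Suc.prems(1,2)) auto
    show "open (V \<inter> W)" "p \<in> V \<inter> W" using Suc.prems W by auto
    show "w' q f = (\<Sum>j<k. c j q * v' j q f)" if "q \<in> V \<inter> W" for q f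
    proof -
      have "w' q f = (\<Sum>j<Suc k. c j q * v' j q f)"
        using that unfolding w'_def v'_def
        by (simp only: Int_iff Suc.prems(6) sum_distrib_right sum_divide_distrib right_diff_distrib
            sum_subtractf mult.assoc times_divide_eq_right times_divide_eq_left)
      moreover have "v' k q f = 0" using W(3)[of q] that by (simp add: v'_def)
      ultimately show ?thesis by simp
    qed
    fix a assume a: "\<And>f. (\<Sum>j<k. a j * v' j p f) = 0"
    \<comment> \<open>A relation among the reduced elements is a relation among the original ones; the
      multiples of \<open>v k\<close> that were subtracted determine its last coefficient.\<close>
    define b where "b j = (if j < k then a j else - (\<Sum>i<k. a i * v i p f0) / v k p f0)" for j
    have "(\<Sum>j<Suc k. b j * v j p f) = 0" for f
    proof -
      have "(\<Sum>j<k. b j * v j p f) = (\<Sum>j<k. a j * v j p f)"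
        by (rule sum.cong) (auto simp: b_def)
      then have "(\<Sum>j<Suc k. b j * v j p f) = (\<Sum>j<k. a j * v' j p f)"
        by (simp add: b_def v'_def right_diff_distrib sum_subtractf sum_distrib_right
            sum_divide_distrib mult.assoc)
      then show ?thesis using a by simp
    qed
    from Suc.prems(3)[OF this] show "\<forall>j<k. a j = 0"
      by (metis b_def less_SucI)
  qed
  have "smooth_near A p (c k)"
  proof (rule smooth_near_cong)
    show "smooth_near A p (\<lambda>q. (w q f0 - (\<Sum>j<k. c j q * v j q f0)) / v k q f0)"
      using c f0 by (intro smooth_near_divide smooth_near_diff smooth_near_sum smooth_near_mult
          Suc.prems(1,2)) auto
    show "open (V \<inter> W)" "p \<in> V \<inter> W" using Suc.prems W by auto
    show "(w q f0 - (\<Sum>j<k. c j q * v j q f0)) / v k q f0 = c k q" if "q \<in> V \<inter> W" for q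
      using that W(3)[of q] by (simp add: Suc.prems(6))
  qed
  then show ?case using c less_Suc_eq by auto
qed

end

section \<open>Linear algebra of a CR structure\<close>

lemma re_vec_add: "re_vec (Z + W) = re_vec Z + re_vec W"
  and im_vec_add: "im_vec (Z + W) = im_vec Z + im_vec W"
  and re_vec_zero: "re_vec 0 = 0" and im_vec_zero: "im_vec 0 = 0"
  and re_vec_scale: "re_vec (vscale c Z) = vscale (Re c) (re_vec Z) - vscale (Im c) (im_vec Z)"
  and im_vec_scale: "im_vec (vscale c Z) = vscale (Re c) (im_vec Z) + vscale (Im c) (re_vec Z)"
  and re_vec_cnj: "re_vec (cnj_vec Z) = re_vec Z"
  and im_vec_cnj: "im_vec (cnj_vec Z) = - im_vec Z"
  and re_vec_cplx: "re_vec (cplx_vec v) = v" and im_vec_cplx: "im_vec (cplx_vec v) = 0"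
  by (auto simp: fun_eq_iff re_vec_def im_vec_def cnj_vec_def cplx_vec_def vscale_def)

lemmas re_im_simps = re_vec_add im_vec_add re_vec_zero im_vec_zero re_vec_scale im_vec_scale
  re_vec_cnj im_vec_cnj re_vec_cplx im_vec_cplx

lemma cvec_eqI: "re_vec Z = re_vec W \<Longrightarrow> im_vec Z = im_vec W \<Longrightarrow> Z = W"
  by (auto simp: fun_eq_iff re_vec_def im_vec_def complex_eq_iff)

definition cvec :: "'a tvec \<Rightarrow> 'a tvec \<Rightarrow> 'a ctvec" where
  "cvec v w = (\<lambda>f. Complex (v f) (w f))"

lemma re_cvec: "re_vec (cvec v w) = v" and im_cvec: "im_vec (cvec v w) = w"
  by (auto simp: fun_eq_iff cvec_def re_vec_def im_vec_def)

lemma sum_lessThan_add: "(\<Sum>j<k + l. g j) = (\<Sum>j<k. g j) + (\<Sum>j<l. g (k + j))"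
  for g :: "nat \<Rightarrow> 'b::comm_monoid_add"
  by (induction l) (auto simp: add.assoc)

locale cr_manifold = atlas A for A :: "('a::topological_space, 'n::finite) chart set" +
  fixes m :: nat and E :: "'a \<Rightarrow> 'a ctvec set"
  assumes cr: "cr_structure A m E"
begin

lemma local_frame:
  "\<exists>U F. open U \<and> p \<in> U \<and> (\<forall>i<m. F i \<in> cvfields_on A U) \<and>
        (\<forall>q\<in>U. E q = range (\<lambda>c::nat \<Rightarrow> complex. \<Sum>i<m. vscale (c i) (F i q)) \<and>
               (\<forall>c::nat \<Rightarrow> complex. (\<Sum>i<m. vscale (c i) (F i q)) = 0 \<longrightarrow> (\<forall>i<m. c i = 0)))"
  using cr unfolding cr_structure_def complex_subbundle_def by blast

lemma E_spanned: "\<exists>F. E p = range (\<lambda>c::nat \<Rightarrow> complex. \<Sum>i<m. vscale (c i) (F i))"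
proof -
  obtain U F where "p \<in> U" and
    UF: "\<forall>q\<in>U. E q = range (\<lambda>c::nat \<Rightarrow> complex. \<Sum>i<m. vscale (c i) (F i q)) \<and>
      (\<forall>c::nat \<Rightarrow> complex. (\<Sum>i<m. vscale (c i) (F i q)) = 0 \<longrightarrow> (\<forall>i<m. c i = 0))"
    using local_frame[of p] by auto
  then show ?thesis by (intro exI[of _ "\<lambda>i. F i p"]) simp
qed

lemma E_add: assumes "Z \<in> E p" "W \<in> E p" shows "Z + W \<in> E p"
proof -
  obtain F where F: "E p = range (\<lambda>c::nat \<Rightarrow> complex. \<Sum>i<m. vscale (c i) (F i))"
    using E_spanned by blast
  obtain a b where "Z = (\<Sum>i<m. vscale (a i) (F i))" "W = (\<Sum>i<m. vscale (b i) (F i))"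
    using assms unfolding F by blast
  then have "Z + W = (\<Sum>i<m. vscale (a i + b i) (F i))"
    by (auto simp: fun_eq_iff sum_fun_apply vscale_def ring_distribs sum.distrib)
  then show ?thesis unfolding F by (intro range_eqI[where x="\<lambda>i. a i + b i"])
qed

lemma E_vscale: assumes "Z \<in> E p" shows "vscale k Z \<in> E p"
proof -
  obtain F where F: "E p = range (\<lambda>c::nat \<Rightarrow> complex. \<Sum>i<m. vscale (c i) (F i))"
    using E_spanned by blast
  obtain a where "Z = (\<Sum>i<m. vscale (a i) (F i))" using assms unfolding F by blast
  then have "vscale k Z = (\<Sum>i<m. vscale (k * a i) (F i))"
    by (auto simp: fun_eq_iff sum_fun_apply vscale_def sum_distrib_left mult.assoc)
  then show ?thesis unfolding F by (intro range_eqI[where x="\<lambda>i. k * a i"])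
qed

lemma E_zero: "0 \<in> E p"
  using cr by (auto simp: cr_structure_def)

lemma E_tangent: "Z \<in> E p \<Longrightarrow> re_vec Z \<in> tangent_space A p \<and> im_vec Z \<in> tangent_space A p"
  using cr by (auto simp: cr_structure_def complex_subbundle_def ctangent_space_def)

lemma E_uminus: "Z \<in> E p \<Longrightarrow> - Z \<in> E p"
  using E_vscale[of Z p "-1"] by (simp add: vscale_def fun_Compl_def)

text \<open>A vector of type (1,0) is determined by its real part: one with vanishing real part is
  opposite to its conjugate, hence lies in both bundles.\<close>

lemma E_re_zero: assumes "Z \<in> E p" "re_vec Z = 0" shows "Z = 0"
proof -
  have "Z = cnj_vec (- Z)"
    using assms(2) by (auto simp: fun_eq_iff re_vec_def cnj_vec_def complex_eq_iff)
  then have "Z \<in> cnj_bundle E p" using E_uminus[OF assms(1)] by (auto simp: cnj_bundle_def)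
  then show ?thesis using assms(1) cr by (auto simp: cr_structure_def)
qed

lemma E_re_inj: assumes "Z \<in> E p" "W \<in> E p" "re_vec Z = re_vec W" shows "Z = W"
proof -
  have "Z + - W = 0"
    using assms by (intro E_re_zero[of _ p] E_add E_uminus) (auto simp: fun_eq_iff re_vec_def)
  then show ?thesis by simp
qed

text \<open>The real part thus identifies the fibre of \<open>E\<close> with the horizontal space, and by the next
  lemma multiplication by the imaginary unit becomes \<open>Jb\<close>.\<close>

lemma hor_eq: "hor E p = re_vec ` E p"
proof (intro equalityI subsetI)
  fix v assume "v \<in> hor E p"
  then obtain Z W where ZW: "Z \<in> E p" "W \<in> E p" "cplx_vec v = Z + cnj_vec W"
    by (auto simp: hor_def cnj_bundle_def)
  have "v = re_vec (Z + W)"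
    using arg_cong[OF ZW(3), of re_vec] by (simp add: re_im_simps)
  then show "v \<in> re_vec ` E p" using E_add ZW by blast
next
  fix v assume "v \<in> re_vec ` E p"
  then obtain Z where Z: "Z \<in> E p" "v = re_vec Z" by auto
  let ?W = "vscale (1/2) Z"
  have "cplx_vec v = ?W + cnj_vec ?W"
    by (auto simp: fun_eq_iff Z cplx_vec_def cnj_vec_def vscale_def re_vec_def complex_eq_iff)
  moreover have "?W \<in> E p" by (rule E_vscale[OF Z(1)])
  ultimately show "v \<in> hor E p" by (auto simp: hor_def cnj_bundle_def)
qed

lemma Jb_re: assumes Z: "Z \<in> E p" shows "Jb E p (re_vec Z) = - im_vec Z"
  unfolding Jb_def
proof (rule the_equality)
  let ?W = "vscale (1/2) Z"
  have W: "?W \<in> E p" by (rule E_vscale[OF Z])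
  have "cplx_vec (re_vec Z) = ?W + cnj_vec ?W"
    by (auto simp: fun_eq_iff cplx_vec_def cnj_vec_def vscale_def re_vec_def complex_eq_iff)
  moreover have im: "cplx_vec (- im_vec Z) = vscale \<i> (?W - cnj_vec ?W)"
    by (auto simp: fun_eq_iff cplx_vec_def cnj_vec_def vscale_def im_vec_def complex_eq_iff)
  ultimately show "\<exists>W\<in>E p. cplx_vec (re_vec Z) = W + cnj_vec W \<and>
      cplx_vec (- im_vec Z) = vscale \<i> (W - cnj_vec W)"
    using W by blast
  fix w assume "\<exists>V\<in>E p. cplx_vec (re_vec Z) = V + cnj_vec V \<and> cplx_vec w = vscale \<i> (V - cnj_vec V)"
  then obtain V where V: "V \<in> E p" "cplx_vec (re_vec Z) = V + cnj_vec V"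
    "cplx_vec w = vscale \<i> (V - cnj_vec V)" by blast
  have "re_vec V = re_vec ?W"
    using arg_cong[OF V(2), of re_vec] by (auto simp: re_im_simps vscale_apply fun_eq_iff)
  then have "V = ?W" using E_re_inj V W by blast
  then have "cplx_vec w = cplx_vec (- im_vec Z)" using V(3) im by simp
  then show "w = - im_vec Z" by (metis re_vec_cplx)
qed

lemma E_iff: "Z \<in> E p \<longleftrightarrow> re_vec Z \<in> hor E p \<and> im_vec Z = - Jb E p (re_vec Z)"
proof
  assume "Z \<in> E p"
  then show "re_vec Z \<in> hor E p \<and> im_vec Z = - Jb E p (re_vec Z)"
    by (simp add: hor_eq Jb_re)
next
  assume r: "re_vec Z \<in> hor E p \<and> im_vec Z = - Jb E p (re_vec Z)"
  then obtain W where W: "W \<in> E p" "re_vec Z = re_vec W" by (auto simp: hor_eq)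
  then have "Z = W" using r Jb_re[OF W(1)] by (intro cvec_eqI) auto
  then show "Z \<in> E p" using W by simp
qed

lemma hor_tangent: "v \<in> hor E p \<Longrightarrow> v \<in> tangent_space A p"
  using E_tangent by (auto simp: hor_eq)

lemma hor_zero: "0 \<in> hor E p"
  unfolding hor_eq using E_zero re_vec_zero by (metis imageI)

lemma hor_add: "v \<in> hor E p \<Longrightarrow> w \<in> hor E p \<Longrightarrow> v + w \<in> hor E p"
  unfolding hor_eq by (auto simp flip: re_vec_add intro!: imageI E_add)

lemma hor_vscale: assumes "v \<in> hor E p" shows "vscale c v \<in> hor E p"
proof -
  obtain Z where "Z \<in> E p" "v = re_vec Z" using assms by (auto simp: hor_eq)
  moreover have "re_vec (vscale (complex_of_real c) Z) = vscale c (re_vec Z)"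
    by (auto simp: fun_eq_iff vscale_def re_vec_def)
  ultimately show ?thesis unfolding hor_eq using E_vscale by (metis imageI)
qed

lemma hor_uminus: "v \<in> hor E p \<Longrightarrow> - v \<in> hor E p"
  using hor_vscale[of v p "-1"] by (simp add: vscale_def fun_Compl_def)

lemma hor_diff: "v \<in> hor E p \<Longrightarrow> w \<in> hor E p \<Longrightarrow> v - w \<in> hor E p"
  using hor_add[OF _ hor_uminus, of v p w] by simp

lemma Jb_hor: assumes "v \<in> hor E p" shows "Jb E p v \<in> hor E p"
  and Jb_Jb: "Jb E p (Jb E p v) = - v"
proof -
  obtain Z where Z: "Z \<in> E p" "v = re_vec Z" using assms by (auto simp: hor_eq)
  have i: "re_vec (vscale \<i> Z) = Jb E p v" "im_vec (vscale \<i> Z) = v"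
    unfolding Z(2) Jb_re[OF Z(1)] by (auto simp: fun_eq_iff vscale_def re_vec_def im_vec_def)
  show "Jb E p v \<in> hor E p" unfolding hor_eq using i E_vscale[OF Z(1)] by (metis imageI)
  show "Jb E p (Jb E p v) = - v" using i Jb_re[OF E_vscale[OF Z(1)], of \<i>] by simp
qed

lemma Jb_add: assumes "v \<in> hor E p" "w \<in> hor E p" shows "Jb E p (v + w) = Jb E p v + Jb E p w"
proof -
  obtain Z W where ZW: "Z \<in> E p" "v = re_vec Z" "W \<in> E p" "w = re_vec W"
    using assms by (auto simp: hor_eq)
  show ?thesis using Jb_re[OF E_add[OF ZW(1,3)]] by (simp add: re_im_simps ZW Jb_re)
qed

lemma Jb_vscale: assumes "v \<in> hor E p" shows "Jb E p (vscale c v) = vscale c (Jb E p v)"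
proof -
  obtain Z where Z: "Z \<in> E p" "v = re_vec Z" using assms by (auto simp: hor_eq)
  have "re_vec (vscale (complex_of_real c) Z) = vscale c v"
    "im_vec (vscale (complex_of_real c) Z) = vscale c (im_vec Z)"
    by (auto simp: fun_eq_iff vscale_def re_vec_def im_vec_def Z)
  then show ?thesis using Jb_re[OF E_vscale[OF Z(1)], of "complex_of_real c"]
    by (simp add: Jb_re Z) (simp add: vscale_apply fun_eq_iff)
qed

lemma Jb_zero: "Jb E p 0 = 0"
  using Jb_re[OF E_zero, of p] by (simp add: re_im_simps)

text \<open>The field \<open>X - iJX\<close> lies in \<open>E\<close>. Its coefficients \<open>c\<close> in a local frame \<open>F\<close> of \<open>E\<close>, followed by
  their conjugates, are the coefficients of the smooth real field \<open>2X\<close> in the frame of length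
  \<open>2m\<close> formed by \<open>F\<close> and its conjugate. That frame is independent because \<open>E\<close> meets its conjugate
  trivially. So the \<open>c\<close> are smooth, and with them the imaginary part of \<open>X - iJX\<close>.\<close>

lemma Jb_smooth:
  assumes X: "X \<in> sections A (hor E)"
  shows "(\<lambda>p. Jb E p (X p)) \<in> sections A (hor E)"
proof -
  have Xh: "X q \<in> hor E q" and Xv: "X \<in> vfields A" for q
    using X by (auto simp: sections_def)
  have "smooth_near A p (\<lambda>q. Jb E q (X q) f)" for p f
  proof -
    obtain U F where U: "open U" "p \<in> U" and F: "\<And>i. i < m \<Longrightarrow> F i \<in> cvfields_on A U"
      and span: "\<And>q. q \<in> U \<Longrightarrow> E q = range (\<lambda>c::nat \<Rightarrow> complex. \<Sum>i<m. vscale (c i) (F i q))"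
      and indep: "\<And>q c. q \<in> U \<Longrightarrow> (\<Sum>i<m. vscale (c i) (F i q)) = 0 \<Longrightarrow> \<forall>i<m. c i = (0::complex)"
    proof -
      obtain U F where "open U" "p \<in> U" "\<forall>i<m. F i \<in> cvfields_on A U" and
        UF: "\<forall>q\<in>U. E q = range (\<lambda>c::nat \<Rightarrow> complex. \<Sum>i<m. vscale (c i) (F i q)) \<and>
          (\<forall>c::nat \<Rightarrow> complex. (\<Sum>i<m. vscale (c i) (F i q)) = 0 \<longrightarrow> (\<forall>i<m. c i = 0))"
        using local_frame[of p] by auto
      then show ?thesis using that[of U F] by simp
    qed
    define Z where "Z q = cvec (X q) (- Jb E q (X q))" for q
    have ZE: "Z q \<in> E q" for q
      by (simp add: E_iff Z_def re_cvec im_cvec Xh)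
    have "\<exists>c. q \<in> U \<longrightarrow> Z q = (\<Sum>i<m. vscale (c i) (F i q))" for q
      using ZE[of q] span[of q] by auto
    then obtain c where c: "\<And>q. q \<in> U \<Longrightarrow> Z q = (\<Sum>i<m. vscale (c q i) (F i q))" by metis
    define v where "v j q g = (if j < m then F j q g else cnj (F (j - m) q g))" for j q g
    define b where "b j q = (if j < m then c q j else cnj (c q (j - m)))" for j q
    have Fs: "smooth_near A p (\<lambda>q. F i q g)" if i: "i < m" for i g
    proof (cases "g \<in> smooth_funs A")
      case True
      then have "smooth_fun_on A U (\<lambda>q. Re (F i q g))" "smooth_fun_on A U (\<lambda>q. Im (F i q g))"
        using F[OF i] by (auto simp: cvfields_on_def vfields_on_def re_vec_def im_vec_def)
      then have "smooth_near A p (\<lambda>q. Complex (Re (F i q g)) (Im (F i q g)))"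
        using U by (intro smooth_near_Complex smooth_nearI)
      then show ?thesis by simp
    next
      case False
      have "F i q g = 0" if "q \<in> U" for q
        using F[OF i] that False
        by (auto simp: cvfields_on_def vfields_on_def re_vec_def im_vec_def complex_eq_iff
            dest!: bspec[OF _ that] tangent_nonsmooth)
      then show ?thesis
        using U by (intro smooth_near_cong[OF smooth_near_const[of p 0]]) auto
    qed
    have "\<forall>j<m + m. smooth_near A p (b j)"
    proof (rule smooth_frame_coefficients)
      show "smooth_near A p (\<lambda>q. v j q g)" if "j < m + m" for j g
        using that by (cases "j < m")
          (auto simp: v_def intro!: Fs smooth_near_linear[OF bounded_linear_cnj])
      show "smooth_near A p (\<lambda>q. 2 * complex_of_real (X q g))" for g
        using vfield_apply_smooth[OF Xv, of g]
        by (intro smooth_near_mult smooth_near_const smooth_near_linear[OF bounded_linear_of_real])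
          (simp add: smooth_funs_iff)
      show "2 * complex_of_real (X q g) = (\<Sum>j<m + m. b j q * v j q g)" if "q \<in> U" for q g
      proof -
        have "(\<Sum>j<m + m. b j q * v j q g) = Z q g + cnj (Z q g)"
          by (simp add: sum_lessThan_add b_def v_def c[OF that] sum_fun_apply vscale_def)
        then show ?thesis by (simp add: Z_def cvec_def complex_eq_iff)
      qed
      fix a assume a: "\<And>g. (\<Sum>j<m + m. a j * v j p g) = 0"
      define P where "P = (\<Sum>i<m. vscale (a i) (F i p))"
      define Q where "Q = (\<Sum>i<m. vscale (cnj (a (m + i))) (F i p))"
      have PQ: "P \<in> E p" "Q \<in> E p" using span[OF U(2)] by (auto simp: P_def Q_def)
      have "P = cnj_vec (- Q)"
        using a by (simp add: sum_lessThan_add v_def P_def Q_def fun_eq_iff cnj_vec_def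
            sum_fun_apply vscale_def eq_neg_iff_add_eq_0)
      then have "P \<in> cnj_bundle E p" using E_uminus[OF PQ(2)] by (auto simp: cnj_bundle_def)
      then have "P = 0" using PQ cr by (auto simp: cr_structure_def)
      moreover from this have "Q = 0"
        using \<open>P = cnj_vec (- Q)\<close> by (auto simp: fun_eq_iff cnj_vec_def)
      ultimately have "\<forall>i<m. a i = 0" "\<forall>i<m. cnj (a (m + i)) = 0"
        unfolding P_def Q_def by (auto dest!: indep[OF U(2)])
      moreover have "a j = 0" if "\<forall>i<m. a (m + i) = 0" "\<not> j < m" "j < m + m" for j
        using that(1)[rule_format, of "j - m"] that by simp
      ultimately show "\<forall>j<m + m. a j = 0" by auto
    qed (use U in auto)
    moreover have "b i = (\<lambda>q. c q i)" if "i < m" for i using that by (simp add: b_def fun_eq_iff)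
    ultimately have cs: "smooth_near A p (\<lambda>q. c q i)" if "i < m" for i
      using that by (metis trans_less_add1)
    have "smooth_near A p (\<lambda>q. - Im (\<Sum>i<m. c q i * F i q f))"
      by (intro smooth_near_uminus smooth_near_linear[OF bounded_linear_Im] smooth_near_sum
          smooth_near_mult cs Fs) auto
    then show ?thesis
    proof (rule smooth_near_cong[OF _ U])
      fix q assume "q \<in> U"
      from arg_cong[OF c[OF this], of "\<lambda>V. Im (V f)"]
      show "- Im (\<Sum>i<m. c q i * F i q f) = Jb E q (X q) f"
        by (simp add: Z_def cvec_def sum_fun_apply vscale_def)
    qed
  qed
  then have "(\<lambda>p. Jb E p (X p)) \<in> vfields A"
    by (intro vfieldsI) (auto simp: smooth_funs_iff intro!: hor_tangent Jb_hor Xh)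
  then show ?thesis using Xh Jb_hor by (simp add: sections_def)
qed

end

section \<open>Geometry of a pseudo-Hermitian manifold\<close>

locale ph_manifold =
  fixes M :: "('a::{t2_space, second_countable_topology}, 'n::finite) pseudo_hermitian" and m :: nat
  assumes ph_manifold: "pseudo_hermitian_manifold m M"
begin

sublocale cr_manifold "charts M" m "H10 M"
  using ph_manifold by unfold_locales (auto simp: pseudo_hermitian_manifold_def)

abbreviation "T_p \<equiv> tangent_space (charts M)"
abbreviation "\<H> \<equiv> hor (H10 M)"
abbreviation "hsections \<equiv> sections (charts M) (hor (H10 M))"
abbreviation "\<theta> \<equiv> form M"
abbreviation "\<xi> \<equiv> reeb M"
abbreviation "J \<equiv> Jmap M"
abbreviation "P \<equiv> proj_hor M"
abbreviation "g \<equiv> gmetric M"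
abbreviation "JF \<equiv> on_fields (Jmap M)"
abbreviation "PF \<equiv> on_fields (proj_hor M)"

lemma one_form: "one_form (charts M) \<theta>"
  using ph_manifold by (simp add: pseudo_hermitian_manifold_def pseudo_hermitian_form_def)

lemma form_add: "v \<in> T_p p \<Longrightarrow> w \<in> T_p p \<Longrightarrow> \<theta> p (v + w) = \<theta> p v + \<theta> p w"
  using one_form by (simp add: one_form_def)

lemma form_vscale: "v \<in> T_p p \<Longrightarrow> \<theta> p (vscale c v) = c * \<theta> p v"
  using one_form by (simp add: one_form_def)

lemma vscale_minus_one: "vscale (-1) v = - v" for v :: "'b \<Rightarrow> 'c::ring_1"
  by (simp add: fun_eq_iff vscale_apply)

lemma form_uminus: "v \<in> T_p p \<Longrightarrow> \<theta> p (- v) = - \<theta> p v"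
  using form_vscale[of v p "-1"] by (simp add: vscale_minus_one)

lemma form_diff: "v \<in> T_p p \<Longrightarrow> w \<in> T_p p \<Longrightarrow> \<theta> p (v - w) = \<theta> p v - \<theta> p w"
  using form_add[of v p "- w"] by (simp add: form_uminus tangent_space_uminus)

lemma form_smooth: "X \<in> vfields (charts M) \<Longrightarrow> (\<lambda>p. \<theta> p (X p)) \<in> smooth_funs (charts M)"
  using one_form by (simp add: one_form_def smooth_funs_def)

lemma hor_iff: "v \<in> \<H> p \<longleftrightarrow> v \<in> T_p p \<and> \<theta> p v = 0"
  using ph_manifold unfolding pseudo_hermitian_manifold_def pseudo_hermitian_form_def by blast

lemma reeb_field: "\<xi> \<in> vfields (charts M)" and form_reeb: "\<theta> p (\<xi> p) = 1"
  and ext_d1_reeb: "X \<in> vfields (charts M) \<Longrightarrow> ext_d1 \<theta> \<xi> X p = 0"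
  using ph_manifold by (simp_all add: pseudo_hermitian_manifold_def is_reeb_field_def)

lemma reeb_tangent: "\<xi> p \<in> T_p p"
  by (rule vfield_tangent[OF reeb_field])

lemma form_bracket_reeb:
  assumes "X \<in> vfields (charts M)"
  shows "\<theta> p (lie_bracket \<xi> X p) = \<xi> p (\<lambda>q. \<theta> q (X q))"
  using ext_d1_reeb[OF assms, of p]
  by (simp add: ext_d1_def form_reeb tangent_const[OF vfield_tangent[OF assms]])

subsection \<open>The horizontal projection and the endomorphism J\<close>

lemma proj_hor_eq:
  assumes v: "v \<in> T_p p" shows "P p v = v - vscale (\<theta> p v) (\<xi> p)"
  unfolding proj_hor_def
proof (rule the_equality)
  show "v - vscale (\<theta> p v) (\<xi> p) \<in> \<H> p \<and>
      (\<exists>c. v = v - vscale (\<theta> p v) (\<xi> p) + vscale c (\<xi> p))"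
    by (intro conjI exI[of _ "\<theta> p v"])
      (simp_all add: hor_iff form_diff form_vscale form_reeb v reeb_tangent tangent_space_intros)
  fix u assume "u \<in> \<H> p \<and> (\<exists>c. v = u + vscale c (\<xi> p))"
  then obtain c where c: "v = u + vscale c (\<xi> p)" and u: "u \<in> T_p p" "\<theta> p u = 0"
    by (auto simp: hor_iff)
  have "\<theta> p v = c"
    by (simp add: c form_add form_vscale form_reeb u reeb_tangent tangent_space_vscale)
  then show "u = v - vscale (\<theta> p v) (\<xi> p)" using c by simp
qed

lemma proj_hor_hor: "v \<in> T_p p \<Longrightarrow> P p v \<in> \<H> p"
  by (simp add: proj_hor_eq hor_iff form_diff form_vscale form_reeb reeb_tangent tangent_space_intros)

lemma proj_hor_id: "v \<in> \<H> p \<Longrightarrow> P p v = v"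
  by (simp add: proj_hor_eq hor_iff) (simp add: fun_eq_iff vscale_apply)

lemma proj_hor_reeb: "P p (\<xi> p) = 0"
  by (simp add: proj_hor_eq reeb_tangent form_reeb) (simp add: fun_eq_iff vscale_apply)

lemma proj_hor_add: "v \<in> T_p p \<Longrightarrow> w \<in> T_p p \<Longrightarrow> P p (v + w) = P p v + P p w"
  by (simp add: proj_hor_eq tangent_space_intros form_add)
    (simp add: fun_eq_iff vscale_apply algebra_simps)

lemma proj_hor_vscale: "v \<in> T_p p \<Longrightarrow> P p (vscale c v) = vscale c (P p v)"
  by (simp add: proj_hor_eq tangent_space_intros form_vscale)
    (simp add: fun_eq_iff vscale_apply algebra_simps)

lemma proj_hor_uminus: "v \<in> T_p p \<Longrightarrow> P p (- v) = - P p v"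
  using proj_hor_vscale[of v p "-1"] by (simp add: vscale_minus_one)

lemma proj_hor_diff: "v \<in> T_p p \<Longrightarrow> w \<in> T_p p \<Longrightarrow> P p (v - w) = P p v - P p w"
  using proj_hor_add[of v p "- w"] by (simp add: proj_hor_uminus tangent_space_uminus)

lemma hor_decomp: "v \<in> T_p p \<Longrightarrow> v = P p v + vscale (\<theta> p v) (\<xi> p)"
  by (simp add: proj_hor_eq)

lemma J_hor_eq: "v \<in> \<H> p \<Longrightarrow> J p v = Jb (H10 M) p v"
  by (simp add: Jmap_def proj_hor_id)

lemma J_hor: "v \<in> T_p p \<Longrightarrow> J p v \<in> \<H> p"
  by (simp add: Jmap_def proj_hor_hor Jb_hor)

lemma J_tangent: "v \<in> T_p p \<Longrightarrow> J p v \<in> T_p p"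
  using J_hor hor_tangent by blast

lemma J_add: "v \<in> T_p p \<Longrightarrow> w \<in> T_p p \<Longrightarrow> J p (v + w) = J p v + J p w"
  by (simp add: Jmap_def proj_hor_add proj_hor_hor Jb_add)

lemma J_vscale: "v \<in> T_p p \<Longrightarrow> J p (vscale c v) = vscale c (J p v)"
  by (simp add: Jmap_def proj_hor_vscale proj_hor_hor Jb_vscale)

lemma J_uminus: "v \<in> T_p p \<Longrightarrow> J p (- v) = - J p v"
  using J_vscale[of v p "-1"] by (simp add: vscale_minus_one)

lemma J_diff: "v \<in> T_p p \<Longrightarrow> w \<in> T_p p \<Longrightarrow> J p (v - w) = J p v - J p w"
  using J_add[of v p "- w"] by (simp add: J_uminus tangent_space_uminus)

lemma J_zero: "J p 0 = 0"
  by (simp add: J_hor_eq hor_zero Jb_zero)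

lemma J_reeb: "J p (\<xi> p) = 0"
  by (simp add: Jmap_def proj_hor_reeb Jb_zero)

lemma J_J: "v \<in> T_p p \<Longrightarrow> J p (J p v) = - P p v"
  unfolding J_hor_eq[OF J_hor] by (simp add: Jmap_def Jb_Jb proj_hor_hor)

lemma J_proj_hor: "v \<in> T_p p \<Longrightarrow> J p (P p v) = J p v"
  by (simp add: Jmap_def proj_hor_id proj_hor_hor)

lemma proj_hor_J: "v \<in> T_p p \<Longrightarrow> P p (J p v) = J p v"
  by (simp add: proj_hor_id J_hor)

lemma form_J: "v \<in> T_p p \<Longrightarrow> \<theta> p (J p v) = 0"
  using J_hor hor_iff by blast

lemma hsectionsD: "X \<in> hsections \<Longrightarrow> X \<in> vfields (charts M)" "X \<in> hsections \<Longrightarrow> X p \<in> \<H> p"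
  by (simp_all add: sections_def)

lemma on_fields_apply: "on_fields L X p = L p (X p)"
  by (simp add: on_fields_def)

lemma PF_eq: "X \<in> vfields (charts M) \<Longrightarrow> PF X = X - fscale (\<lambda>p. \<theta> p (X p)) \<xi>"
  by (rule ext) (simp add: on_fields_apply proj_hor_eq vfield_tangent fscale_apply)

lemma PF_hsections: "X \<in> vfields (charts M) \<Longrightarrow> PF X \<in> hsections"
  by (simp add: sections_def on_fields_apply proj_hor_hor vfield_tangent)
    (simp add: PF_eq vfields_diff vfields_fscale form_smooth reeb_field)

lemma field_decomp: "X \<in> vfields (charts M) \<Longrightarrow> X = PF X + fscale (\<lambda>p. \<theta> p (X p)) \<xi>"
  by (simp add: PF_eq)

lemma JF_hsections: assumes "X \<in> vfields (charts M)" shows "JF X \<in> hsections"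
proof -
  have "JF X = (\<lambda>p. Jb (H10 M) p (PF X p))"
    by (simp add: fun_eq_iff on_fields_apply Jmap_def)
  then show ?thesis using Jb_smooth[OF PF_hsections[OF assms]] by simp
qed

lemmas JF_vfields = hsectionsD(1)[OF JF_hsections]
lemmas PF_vfields = hsectionsD(1)[OF PF_hsections]

lemma JF_JF: "X \<in> hsections \<Longrightarrow> JF (JF X) = - X"
  by (rule ext) (simp add: on_fields_apply J_J proj_hor_id hsectionsD hor_tangent)

subsection \<open>The metric\<close>

lemma hermitian: "hermitian_fiber_metric (charts M) (H10 M) (hmetric M)"
  using ph_manifold by (simp add: pseudo_hermitian_manifold_def)

lemma h_add: "u \<in> \<H> p \<Longrightarrow> v \<in> \<H> p \<Longrightarrow> w \<in> \<H> p \<Longrightarrow>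
    hmetric M p (u + v) w = hmetric M p u w + hmetric M p v w"
  and h_vscale: "u \<in> \<H> p \<Longrightarrow> v \<in> \<H> p \<Longrightarrow> hmetric M p (vscale c u) v = c * hmetric M p u v"
  and h_sym: "u \<in> \<H> p \<Longrightarrow> v \<in> \<H> p \<Longrightarrow> hmetric M p u v = hmetric M p v u"
  and h_pos: "u \<in> \<H> p \<Longrightarrow> u \<noteq> 0 \<Longrightarrow> hmetric M p u u > 0"
  and h_Jb: "u \<in> \<H> p \<Longrightarrow> v \<in> \<H> p \<Longrightarrow>
    hmetric M p (Jb (H10 M) p u) (Jb (H10 M) p v) = hmetric M p u v"
  using hermitian by (simp_all add: hermitian_fiber_metric_def)

lemma g_add: "u \<in> T_p p \<Longrightarrow> v \<in> T_p p \<Longrightarrow> w \<in> T_p p \<Longrightarrow> g p (u + v) w = g p u w + g p v w"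
  by (simp add: gmetric_def htensor_def proj_hor_add h_add proj_hor_hor form_add algebra_simps)

lemma g_vscale: "u \<in> T_p p \<Longrightarrow> v \<in> T_p p \<Longrightarrow> g p (vscale c u) v = c * g p u v"
  by (simp add: gmetric_def htensor_def proj_hor_vscale h_vscale proj_hor_hor form_vscale algebra_simps)

lemma g_uminus: "u \<in> T_p p \<Longrightarrow> v \<in> T_p p \<Longrightarrow> g p (- u) v = - g p u v"
  using g_vscale[of u p v "-1"] by (simp add: vscale_minus_one)

lemma g_diff: "u \<in> T_p p \<Longrightarrow> v \<in> T_p p \<Longrightarrow> w \<in> T_p p \<Longrightarrow> g p (u - v) w = g p u w - g p v w"
  using g_add[of u p "- v" w] by (simp add: g_uminus tangent_space_uminus)

lemma g_sym: "u \<in> T_p p \<Longrightarrow> v \<in> T_p p \<Longrightarrow> g p u v = g p v u"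
  by (simp add: gmetric_def htensor_def h_sym proj_hor_hor)

lemma h_zero: "u \<in> \<H> p \<Longrightarrow> hmetric M p 0 u = 0"
  using h_vscale[of u p u 0] by (simp add: vscale_def zero_fun_def)

lemma g_reeb: "u \<in> T_p p \<Longrightarrow> g p (\<xi> p) u = \<theta> p u"
  by (simp add: gmetric_def htensor_def proj_hor_reeb h_zero proj_hor_hor form_reeb)

lemma g_definite: assumes v: "v \<in> T_p p" and "g p v v = 0" shows "v = 0"
proof -
  have "hmetric M p (P p v) (P p v) \<ge> 0"
    using h_pos[OF proj_hor_hor[OF v]] h_zero[OF proj_hor_hor[OF v]]
    by (cases "P p v = 0") (auto intro: less_imp_le)
  then have "\<theta> p v = 0" "hmetric M p (P p v) (P p v) = 0"
    using assms(2) by (auto simp: gmetric_def htensor_def add_nonneg_eq_0_iff)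
  then have "P p v = 0" using h_pos[OF proj_hor_hor[OF v]] by fastforce
  then show ?thesis using hor_decomp[OF v] \<open>\<theta> p v = 0\<close> by (simp add: fun_eq_iff vscale_apply)
qed

lemma g_hor: "u \<in> T_p p \<Longrightarrow> v \<in> \<H> p \<Longrightarrow> g p (P p u) v = g p u v"
  by (simp add: gmetric_def htensor_def proj_hor_id proj_hor_hor) (simp add: hor_iff)

lemma g_J_J: "u \<in> T_p p \<Longrightarrow> v \<in> T_p p \<Longrightarrow> g p (J p u) (J p v) = g p (P p u) (P p v)"
  by (simp add: gmetric_def htensor_def proj_hor_J form_J proj_hor_id proj_hor_hor)
    (use proj_hor_hor hor_iff in \<open>auto simp: Jmap_def h_Jb\<close>)

lemma g_J_skew: assumes u: "u \<in> T_p p" and v: "v \<in> T_p p" shows "g p (J p u) v = - g p u (J p v)"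
proof -
  note t = u v J_tangent[OF u] J_tangent[OF v] hor_tangent[OF proj_hor_hor[OF u]]
    hor_tangent[OF proj_hor_hor[OF v]] tangent_space_uminus
  have "g p (J p u) v = g p (J p u) (P p v)"
    using g_hor[OF v J_hor[OF u]] by (simp add: g_sym t)
  also have "\<dots> = - g p (J p u) (J p (J p v))"
    using g_uminus[OF t(6) t(3)] by (simp add: J_J t g_sym)
  also have "\<dots> = - g p (P p u) (J p v)"
    by (simp add: g_J_J t proj_hor_J)
  also have "\<dots> = - g p u (J p v)"
    by (simp add: g_hor t J_hor)
  finally show ?thesis .
qed

subsection \<open>The type decomposition\<close>

lemma E_iff_J: "Z \<in> H10 M p \<longleftrightarrow> re_vec Z \<in> \<H> p \<and> im_vec Z = - J p (re_vec Z)"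
  by (auto simp: E_iff J_hor_eq)

lemma H01_iff_J: "Z \<in> H01 M p \<longleftrightarrow> re_vec Z \<in> \<H> p \<and> im_vec Z = J p (re_vec Z)"
proof -
  have "cnj_vec (cnj_vec Z) = Z" for Z :: "'a ctvec" by (simp add: cnj_vec_def)
  then have "Z \<in> H01 M p \<longleftrightarrow> cnj_vec Z \<in> H10 M p"
    unfolding H01_def cnj_bundle_def by (metis imageE imageI)
  then show ?thesis by (simp add: E_iff_J re_im_simps)
qed

text \<open>If \<open>u\<close>, \<open>v\<close> are the real parts of the (1,0) and (0,1) components of \<open>Z\<close>, then \<open>u + v\<close> is the
  horizontal part of \<open>Re Z\<close> and \<open>u - v\<close> is \<open>J (Im Z)\<close>. Solving for \<open>u\<close> and \<open>v\<close> gives the uniqueness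
  of the decomposition and an explicit form of the projections.\<close>

lemma type_components:
  assumes U: "U \<in> H10 M p" and V: "V \<in> H01 M p" and R: "R \<in> reeb_line M p"
    and Z: "Z = U + V + R"
  shows "re_vec U = vscale (1/2) (P p (re_vec Z) + J p (im_vec Z))"
    and "re_vec V = vscale (1/2) (P p (re_vec Z) - J p (im_vec Z))"
proof -
  define u v where "u = re_vec U" and "v = re_vec V"
  obtain c where R: "R = vscale c (cplx_vec (\<xi> p))" using R by (auto simp: reeb_line_def)
  have h: "u \<in> \<H> p" "v \<in> \<H> p" and im: "im_vec U = - J p u" "im_vec V = J p v"
    using U V by (auto simp: E_iff_J H01_iff_J u_def v_def)
  note t = h[THEN hor_tangent] reeb_tangent
  note tt = t J_tangent tangent_space_intros
  have re: "re_vec Z = u + v + vscale (Re c) (\<xi> p)"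
    by (simp add: Z R re_im_simps u_def v_def) (simp add: fun_eq_iff vscale_apply)
  have im: "im_vec Z = J p (v - u) + vscale (Im c) (\<xi> p)"
    by (simp add: Z R re_im_simps im J_diff t) (simp add: fun_eq_iff vscale_apply)
  have "P p (re_vec Z) = u + v"
    by (simp add: re proj_hor_add proj_hor_vscale proj_hor_reeb proj_hor_id h tt)
      (simp add: fun_eq_iff vscale_apply)
  moreover have "J p (im_vec Z) = u - v"
    by (simp add: im J_add J_vscale J_reeb J_J proj_hor_id h hor_diff tt)
      (simp add: fun_eq_iff vscale_apply)
  ultimately show "re_vec U = vscale (1/2) (P p (re_vec Z) + J p (im_vec Z))"
    and "re_vec V = vscale (1/2) (P p (re_vec Z) - J p (im_vec Z))"
    by (simp_all add: fun_eq_iff vscale_apply u_def v_def)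
qed

lemma proj_plus_sum:
  assumes "U \<in> H10 M p" "V \<in> H01 M p" "R \<in> reeb_line M p"
  shows "proj_plus M p (U + V + R) = U"
  unfolding proj_plus_def
proof (rule the_equality)
  show "U \<in> H10 M p \<and> (\<exists>V'\<in>H01 M p. \<exists>R'\<in>reeb_line M p. U + V + R = U + V' + R')"
    using assms by blast
  fix U' assume U': "U' \<in> H10 M p \<and> (\<exists>V'\<in>H01 M p. \<exists>R'\<in>reeb_line M p. U + V + R = U' + V' + R')"
  then have "re_vec U' = re_vec U"
    using type_components(1)[OF assms refl] type_components(1)[of U' p] by metis
  then show "U' = U" using U' assms(1) by (simp add: E_iff_J cvec_eqI)
qed

lemma proj_minus_sum:
  assumes "U \<in> H10 M p" "V \<in> H01 M p" "R \<in> reeb_line M p"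
  shows "proj_minus M p (U + V + R) = V"
  unfolding proj_minus_def
proof (rule the_equality)
  show "V \<in> H01 M p \<and> (\<exists>U'\<in>H10 M p. \<exists>R'\<in>reeb_line M p. U + V + R = U' + V + R')"
    using assms by blast
  fix V' assume V': "V' \<in> H01 M p \<and> (\<exists>U'\<in>H10 M p. \<exists>R'\<in>reeb_line M p. U + V + R = U' + V' + R')"
  then have "re_vec V' = re_vec V"
    using type_components(2)[OF assms refl] type_components(2)[of _ p V'] by metis
  then show "V' = V" using V' assms(2) by (simp add: H01_iff_J cvec_eqI)
qed

lemma zero_types: "0 \<in> H10 M p" "0 \<in> H01 M p" "0 \<in> reeb_line M p"
proof -
  show "0 \<in> H10 M p" by (rule E_zero)
  show "0 \<in> H01 M p" by (simp add: H01_iff_J re_im_simps hor_zero J_zero)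
  have "0 = vscale 0 (cplx_vec (\<xi> p))" by (simp add: fun_eq_iff vscale_apply)
  then show "0 \<in> reeb_line M p" unfolding reeb_line_def by (rule range_eqI)
qed

lemma proj_plus_H10: "Z \<in> H10 M p \<Longrightarrow> proj_plus M p Z = Z"
  and proj_minus_H10: "Z \<in> H10 M p \<Longrightarrow> proj_minus M p Z = 0"
  using proj_plus_sum[of Z p 0 0] proj_minus_sum[of Z p 0 0] zero_types by auto

lemma proj_plus_H01: "Z \<in> H01 M p \<Longrightarrow> proj_plus M p Z = 0"
  and proj_minus_H01: "Z \<in> H01 M p \<Longrightarrow> proj_minus M p Z = Z"
  using proj_plus_sum[of 0 p Z 0] proj_minus_sum[of 0 p Z 0] zero_types by auto

text \<open>The fields \<open>X - iJX\<close> and \<open>X + iJX\<close>, which are the sections of \<open>H10\<close> and \<open>H01\<close> when \<open>X\<close> runs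
  over the horizontal fields.\<close>

definition hol :: "'a vfield \<Rightarrow> 'a cvfield" where
  "hol X = (\<lambda>p. cvec (X p) (- J p (X p)))"

definition antihol :: "'a vfield \<Rightarrow> 'a cvfield" where
  "antihol X = (\<lambda>p. cvec (X p) (J p (X p)))"

lemma re_im_hol: "re_vec \<circ> hol X = X" "im_vec \<circ> hol X = - JF X"
  "re_vec \<circ> antihol X = X" "im_vec \<circ> antihol X = JF X"
  by (simp_all add: fun_eq_iff hol_def antihol_def re_cvec im_cvec on_fields_def)

lemma proj_plus_eq:
  assumes Z: "re_vec Z \<in> T_p p" "im_vec Z \<in> T_p p"
  defines "u \<equiv> vscale (1/2) (P p (re_vec Z) + J p (im_vec Z))"
  shows "proj_plus M p Z = cvec u (- J p u)"
proof -
  define v where "v = vscale (1/2) (P p (re_vec Z) - J p (im_vec Z))"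
  define R where "R = vscale (Complex (\<theta> p (re_vec Z)) (\<theta> p (im_vec Z))) (cplx_vec (\<xi> p))"
  have h: "P p (re_vec Z) \<in> \<H> p" "J p (im_vec Z) \<in> \<H> p"
    using Z proj_hor_hor J_hor by auto
  have uv: "u \<in> \<H> p" "v \<in> \<H> p"
    using h by (simp_all add: u_def v_def hor_vscale hor_add hor_diff)
  have "cvec u (- J p u) \<in> H10 M p" "cvec v (J p v) \<in> H01 M p"
    using uv by (simp_all add: E_iff_J H01_iff_J re_cvec im_cvec)
  moreover have "R \<in> reeb_line M p" by (simp add: R_def reeb_line_def)
  moreover have "Z = cvec u (- J p u) + cvec v (J p v) + R"
  proof (rule cvec_eqI)
    show "re_vec Z = re_vec (cvec u (- J p u) + cvec v (J p v) + R)"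
      by (simp add: re_im_simps re_cvec R_def u_def v_def)
        (use hor_decomp[OF Z(1)] in \<open>simp add: fun_eq_iff vscale_apply add_divide_distrib diff_divide_distrib\<close>)
    have vu: "v - u = - J p (im_vec Z)"
      by (simp add: fun_eq_iff vscale_apply u_def v_def add_divide_distrib diff_divide_distrib)
    have "J p v - J p u = J p (v - u)" using uv by (simp add: J_diff hor_tangent)
    also have "\<dots> = P p (im_vec Z)" unfolding vu using Z by (simp add: J_uminus J_tangent J_J)
    finally have "J p v - J p u = P p (im_vec Z)" .
    then show "im_vec Z = im_vec (cvec u (- J p u) + cvec v (J p v) + R)"
      by (simp add: re_im_simps im_cvec R_def)
        (use hor_decomp[OF Z(2)] in \<open>simp add: fun_eq_iff vscale_apply\<close>)
  qed
  ultimately show ?thesis using proj_plus_sum by metis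
qed

end

section \<open>The canonical connection\<close>

lemma re_cbilin: "re_vec (cbilin B Z W p) =
    B (re_vec \<circ> Z) (re_vec \<circ> W) p - B (im_vec \<circ> Z) (im_vec \<circ> W) p"
  and im_cbilin: "im_vec (cbilin B Z W p) =
    B (re_vec \<circ> Z) (im_vec \<circ> W) p + B (im_vec \<circ> Z) (re_vec \<circ> W) p"
  by (simp_all add: fun_eq_iff cbilin_def re_vec_def im_vec_def)

lemma vscale_zero: "vscale c 0 = 0" for c :: "'c::mult_zero"
  by (simp add: fun_eq_iff vscale_apply)

lemma cvec_zero: "cvec 0 0 = 0"
  by (rule cvec_eqI) (simp_all add: re_cvec im_cvec re_im_simps)

lemma re_im_cplx_field: "re_vec \<circ> (\<lambda>p. cplx_vec (X p)) = X" "im_vec \<circ> (\<lambda>p. cplx_vec (X p)) = 0"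
  by (simp_all add: fun_eq_iff cplx_vec_def re_vec_def im_vec_def)

locale canonical_ph_manifold = ph_manifold M m
  for M :: "('a::{t2_space, second_countable_topology}, 'n::finite) pseudo_hermitian" and m :: nat +
  fixes D :: "'a connection"
  assumes canonical: "canonical_connection M D"
begin

abbreviation "\<X> \<equiv> vfields (charts M)"
abbreviation "T \<equiv> torsion D"
abbreviation "\<tau> \<equiv> tor_tau M D"
abbreviation "\<sigma> \<equiv> tor_sigma M D"
abbreviation "\<Omega> \<equiv> pseudo_kaehler_form M"

lemma linear_connection: "linear_connection (charts M) D"
  and preserves_H10: "preserves_bundle (charts M) D (H10 M)"
  and preserves_reeb_line: "preserves_bundle (charts M) D (reeb_line M)"
  and metric_connection: "metric_connection (charts M) D g"
  using canonical by (simp_all add: canonical_connection_def pseudo_hermitian_connection_def)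

lemma D_vfields: "X \<in> \<X> \<Longrightarrow> Y \<in> \<X> \<Longrightarrow> D X Y \<in> \<X>"
  and D_add_left: "X \<in> \<X> \<Longrightarrow> X' \<in> \<X> \<Longrightarrow> Y \<in> \<X> \<Longrightarrow> D (X + X') Y = D X Y + D X' Y"
  and D_add_right: "X \<in> \<X> \<Longrightarrow> Y \<in> \<X> \<Longrightarrow> Y' \<in> \<X> \<Longrightarrow> D X (Y + Y') = D X Y + D X Y'"
  and D_fscale_left: "f \<in> smooth_funs (charts M) \<Longrightarrow> X \<in> \<X> \<Longrightarrow> Y \<in> \<X> \<Longrightarrow>
    D (fscale f X) Y = fscale f (D X Y)"
  and D_fscale_right: "f \<in> smooth_funs (charts M) \<Longrightarrow> X \<in> \<X> \<Longrightarrow> Y \<in> \<X> \<Longrightarrow>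
    D X (fscale f Y) = fscale (\<lambda>p. X p f) Y + fscale f (D X Y)"
  using linear_connection unfolding linear_connection_def by blast+

lemma D_zero_left: "Y \<in> \<X> \<Longrightarrow> D 0 Y = 0"
  using D_add_left[OF vfields_zero vfields_zero, of Y] by simp

lemma D_zero_right: "X \<in> \<X> \<Longrightarrow> D X 0 = 0"
  using D_add_right[OF _ vfields_zero vfields_zero, of X] by simp

lemma D_uminus_right: "X \<in> \<X> \<Longrightarrow> Y \<in> \<X> \<Longrightarrow> D X (- Y) = - D X Y"
  using D_add_right[of X Y "- Y"] by (simp add: vfields_uminus D_zero_right eq_neg_iff_add_eq_0 add.commute)

lemma D_metric: "X \<in> \<X> \<Longrightarrow> Y \<in> \<X> \<Longrightarrow> Z \<in> \<X> \<Longrightarrow>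
    X p (\<lambda>q. g q (Y q) (Z q)) = g p (D X Y p) (Z p) + g p (Y p) (D X Z p)"
  using metric_connection by (simp add: metric_connection_def)

lemma cplx_cvfields: "X \<in> \<X> \<Longrightarrow> (\<lambda>p. cplx_vec (X p)) \<in> cvfields (charts M)"
  by (simp add: cvfields_on_def re_im_cplx_field vfields_zero)

lemma hol_csections: "X \<in> hsections \<Longrightarrow> hol X \<in> csections (charts M) (H10 M)"
  by (simp add: csections_def cvfields_on_def re_im_hol hsectionsD JF_vfields vfields_uminus E_iff_J)
    (simp add: hol_def re_cvec im_cvec hsectionsD)

lemma antihol_csections: "X \<in> hsections \<Longrightarrow> antihol X \<in> csections (charts M) (H01 M)"
  by (simp add: csections_def cvfields_on_def re_im_hol hsectionsD JF_vfields H01_iff_J)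
    (simp add: antihol_def re_cvec im_cvec hsectionsD)

text \<open>Preservation of the Reeb line gives a multiple of \<open>\<xi>\<close>; the factor is half the derivative of
  the constant function \<open>g(\<xi>,\<xi>) = 1\<close>.\<close>

lemma D_reeb: assumes X: "X \<in> \<X>" shows "D X \<xi> = 0"
proof
  fix p
  let ?Z = "\<lambda>p. cplx_vec (\<xi> p)"
  have "?Z p \<in> reeb_line M p" for p
    unfolding reeb_line_def
    by (rule range_eqI[where x=1]) (simp add: fun_eq_iff vscale_apply)
  then have "?Z \<in> csections (charts M) (reeb_line M)"
    by (simp add: csections_def cplx_cvfields reeb_field)
  then have "cbilin D (\<lambda>p. cplx_vec (X p)) ?Z p \<in> reeb_line M p"
    using preserves_reeb_line cplx_cvfields[OF X]
    unfolding preserves_bundle_def csections_def by blast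
  then obtain c where c: "cbilin D (\<lambda>p. cplx_vec (X p)) ?Z p = vscale c (cplx_vec (\<xi> p))"
    by (auto simp: reeb_line_def)
  have D: "D X \<xi> p = vscale (Re c) (\<xi> p)"
    using arg_cong[OF c, of re_vec]
    by (simp add: re_cbilin re_im_cplx_field D_zero_left vfields_zero re_im_simps)
      (simp add: fun_eq_iff vscale_apply)
  have "X p (\<lambda>q. g q (\<xi> q) (\<xi> q)) = 2 * Re c"
    unfolding D_metric[OF X reeb_field reeb_field]
    by (simp add: D g_vscale g_sym[of "\<xi> p" p] tangent_space_vscale
        reeb_tangent g_reeb form_reeb form_vscale)
  then have "Re c = 0"
    by (simp add: g_reeb reeb_tangent form_reeb tangent_const[OF vfield_tangent[OF X]])
  then show "D X \<xi> p = 0 p" using D by (simp add: fun_eq_iff vscale_apply)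
qed

text \<open>This is preservation of \<open>H10\<close>, read at the section \<open>Y - iJY\<close>. It extends to all fields by the
  next lemma because \<open>\<xi>\<close> is parallel and killed by \<open>J\<close>.\<close>

lemma D_hsections:
  assumes X: "X \<in> \<X>" and Y: "Y \<in> hsections"
  shows "D X Y \<in> hsections" and "D X (JF Y) = JF (D X Y)"
proof -
  note Yv = hsectionsD(1)[OF Y]
  have "cbilin D (\<lambda>p. cplx_vec (X p)) (hol Y) p \<in> H10 M p" for p
    using preserves_H10 cplx_cvfields[OF X] hol_csections[OF Y]
    unfolding preserves_bundle_def csections_def by blast
  then have *: "D X Y p \<in> \<H> p \<and> D X (JF Y) p = J p (D X Y p)" for p
    by (simp add: E_iff_J re_cbilin im_cbilin re_im_cplx_field re_im_hol D_zero_left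
        D_uminus_right X Yv JF_vfields vfields_uminus)
  then show "D X Y \<in> hsections" by (simp add: sections_def D_vfields X Yv)
  show "D X (JF Y) = JF (D X Y)" using * by (auto simp: on_fields_apply)
qed

lemma D_J:
  assumes X: "X \<in> \<X>" and Y: "Y \<in> \<X>"
  shows "D X (JF Y) = JF (D X Y)"
proof -
  define u where "u = (\<lambda>p. \<theta> p (Y p))"
  have u: "u \<in> smooth_funs (charts M)" using form_smooth[OF Y] by (simp add: u_def)
  note PY = PF_vfields[OF Y]
  have "D X Y = D X (PF Y) + D X (fscale u \<xi>)"
    using field_decomp[OF Y] D_add_right[OF X PY vfields_fscale[OF u reeb_field]] by (simp add: u_def)
  also have "D X (fscale u \<xi>) = fscale (\<lambda>p. X p u) \<xi>"
    by (simp add: D_fscale_right X u reeb_field D_reeb) (simp add: fun_eq_iff fscale_apply vscale_apply)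
  finally have e: "D X Y = D X (PF Y) + fscale (\<lambda>p. X p u) \<xi>" .
  have e': "D X Y p = D X (PF Y) p + vscale (X p u) (\<xi> p)" for p
    by (rule ext) (simp add: e fscale_apply vscale_apply)
  have "J p (D X Y p) = J p (D X (PF Y) p)" for p
    by (subst e') (simp add: J_add J_vscale J_reeb tangent_space_vscale vscale_zero
        reeb_tangent vfield_tangent[OF D_vfields[OF X PY]])
  then have "JF (D X Y) = D X (JF (PF Y))"
    unfolding D_hsections(2)[OF X PF_hsections[OF Y]] by (intro ext) (simp add: on_fields_apply)
  also have "JF (PF Y) = JF Y"
    by (rule ext) (simp add: on_fields_apply J_proj_hor vfield_tangent Y)
  finally show ?thesis by simp
qed

lemma form_D:
  assumes "X \<in> \<X>" "Y \<in> \<X>" shows "\<theta> p (D X Y p) = X p (\<lambda>q. \<theta> q (Y q))"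
proof -
  have "X p (\<lambda>q. g q (\<xi> q) (Y q)) = g p (\<xi> p) (D X Y p)"
    using D_metric[OF assms(1) reeb_field assms(2), of p] g_vscale[of "\<xi> p" p "Y p" 0]
    by (simp add: D_reeb assms vfield_tangent reeb_tangent vscale_def flip: zero_fun_def)
  then show ?thesis by (simp add: g_reeb vfield_tangent D_vfields assms)
qed

subsection \<open>Torsion\<close>

lemma T_vfields: "X \<in> \<X> \<Longrightarrow> Y \<in> \<X> \<Longrightarrow> T X Y \<in> \<X>"
  by (simp add: torsion_def vfields_diff D_vfields vfields_lie_bracket)

lemma T_tangent: "X \<in> \<X> \<Longrightarrow> Y \<in> \<X> \<Longrightarrow> T X Y p \<in> T_p p"
  by (rule vfield_tangent[OF T_vfields])

lemma T_flip: "T X Y = - T Y X"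
  by (subst (2) torsion_def, subst torsion_def, subst lie_bracket_flip) simp

lemma T_add_left: "X \<in> \<X> \<Longrightarrow> X' \<in> \<X> \<Longrightarrow> Y \<in> \<X> \<Longrightarrow> T (X + X') Y = T X Y + T X' Y"
  by (simp add: torsion_def D_add_left D_add_right lie_bracket_add_left)

lemma T_fscale_left: "f \<in> smooth_funs (charts M) \<Longrightarrow> X \<in> \<X> \<Longrightarrow> Y \<in> \<X> \<Longrightarrow>
    T (fscale f X) Y = fscale f (T X Y)"
  by (simp add: torsion_def D_fscale_left D_fscale_right lie_bracket_fscale_left)
    (simp add: fun_eq_iff fscale_apply vscale_apply algebra_simps)

lemma T_zero_left: "Y \<in> \<X> \<Longrightarrow> T 0 Y = 0"
  using T_add_left[OF vfields_zero vfields_zero, of Y] by simp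

lemma T_uminus_left: "X \<in> \<X> \<Longrightarrow> Y \<in> \<X> \<Longrightarrow> T (- X) Y = - T X Y"
  using T_add_left[of X "- X" Y] by (simp add: vfields_uminus T_zero_left eq_neg_iff_add_eq_0 add.commute)

lemma T_uminus_right: "X \<in> \<X> \<Longrightarrow> Y \<in> \<X> \<Longrightarrow> T X (- Y) = - T X Y"
  using T_uminus_left[of Y X] T_flip[of X "- Y"] T_flip[of X Y] by simp

text \<open>Both \<open>D \<xi> X\<close> and the bracket of \<open>\<xi>\<close> with \<open>X\<close> have \<open>\<theta>\<close>-component \<open>\<xi>(\<theta>(X))\<close>: the first
  since \<open>\<xi>\<close> is parallel, the second since \<open>\<xi>\<close> is in the kernel of \<open>d\<theta>\<close>.\<close>

lemma tau_hsections: assumes X: "X \<in> \<X>" shows "\<tau> X \<in> hsections"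
proof -
  have "\<theta> p (\<tau> X p) = 0" for p
    by (simp add: tor_tau_def torsion_def D_reeb X form_diff form_D form_bracket_reeb reeb_field
        vfield_tangent D_vfields vfields_lie_bracket vfields_zero vfields_diff)
  then show ?thesis
    by (simp add: sections_def hor_iff tor_tau_def T_tangent T_vfields X reeb_field)
qed

lemma tau_reeb: "\<tau> \<xi> = 0"
proof -
  have "T \<xi> \<xi> p f = - T \<xi> \<xi> p f" for p f
    using T_flip[of \<xi> \<xi>] by (metis uminus_apply)
  then show ?thesis by (simp add: fun_eq_iff tor_tau_def)
qed

text \<open>Integrability, together with the preservation of \<open>H10\<close>, says that the torsion of \<open>X - iJX\<close>
  and \<open>Y - iJY\<close> is of type (1,0), so that \<open>J\<close> turns its real part into minus its imaginary part.\<close>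

lemma torsion_integrable:
  assumes X: "X \<in> hsections" and Y: "Y \<in> hsections"
  shows "T X (JF Y) p + T (JF X) Y p = J p (T X Y p - T (JF X) (JF Y) p)"
proof -
  note v = hsectionsD(1)[OF X] hsectionsD(1)[OF Y]
  note Jv = JF_vfields[OF v(1)] JF_vfields[OF v(2)]
  have lb: "lie_bracket (- X) Y = - lie_bracket X Y" if "X \<in> \<X>" "Y \<in> \<X>" for X Y
    using lie_bracket_add_left[of X "- X" Y] lie_bracket_add_left[of 0 0 Y] that
    by (simp add: vfields_uminus vfields_zero eq_neg_iff_add_eq_0 add.commute)
  have lb': "lie_bracket X (- Y) = - lie_bracket X Y" if "X \<in> \<X>" "Y \<in> \<X>" for X Y
    using lb[OF that(2,1)] lie_bracket_flip[of X "- Y"] lie_bracket_flip[of X Y] by simp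
  have "cbilin lie_bracket (hol X) (hol Y) \<in> csections (charts M) (H10 M)"
    using cr hol_csections[OF X] hol_csections[OF Y] by (simp add: cr_structure_def)
  then have "cbilin lie_bracket (hol X) (hol Y) p \<in> H10 M p" by (simp add: csections_def)
  then have i: "lie_bracket X (JF Y) p + lie_bracket (JF X) Y p
      = J p (lie_bracket X Y p - lie_bracket (JF X) (JF Y) p)"
    by (simp add: E_iff_J re_cbilin im_cbilin re_im_hol lb lb' v Jv vfields_uminus)
      (metis (no_types, lifting) add.commute minus_add_distrib minus_minus uminus_add_conv_diff)
  have DJ: "D X (JF Y) p = J p (D X Y p)" if "X \<in> \<X>" "Y \<in> \<X>" for X Y
    using D_J[OF that] by (simp add: on_fields_apply)
  have DJJ: "J p (D X (JF Y) p) = - D X Y p" if "X \<in> \<X>" "Y \<in> hsections" for X Y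
    using that DJ[OF that(1) hsectionsD(1)[OF that(2)]]
    by (simp add: J_J vfield_tangent D_vfields hsectionsD proj_hor_id hsectionsD(2)[OF D_hsections(1)])
  note t = vfield_tangent[OF D_vfields] vfield_tangent[OF vfields_lie_bracket]
  have "J p (T X Y p - T (JF X) (JF Y) p)
      = J p (D X Y p) - J p (D Y X p) - J p (D (JF X) (JF Y) p) + J p (D (JF Y) (JF X) p)
        - J p (lie_bracket X Y p - lie_bracket (JF X) (JF Y) p)"
    by (simp add: torsion_def J_diff t v Jv tangent_space_diff)
  also have "\<dots> = D X (JF Y) p - D Y (JF X) p + D (JF X) Y p - D (JF Y) X p
      - (lie_bracket X (JF Y) p + lie_bracket (JF X) Y p)"
    by (simp add: i DJ[of X Y, symmetric] DJ[of Y X, symmetric] DJJ v Jv X Y del: DJ)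
  finally show ?thesis by (simp add: torsion_def)
qed

text \<open>The vanishing of \<open>\<Theta>\<close> in type (1,1), read at \<open>X - iJX\<close> and \<open>Y + iJY\<close>.\<close>

lemma Theta_hol_antihol:
  assumes X: "X \<in> hsections" and Y: "Y \<in> hsections"
  shows "P p (T X Y p + T (JF X) (JF Y) p) = - J p (T X (JF Y) p - T (JF X) Y p)"
proof -
  note v = hsectionsD(1)[OF X] hsectionsD(1)[OF Y]
  note Jv = JF_vfields[OF v(1)] JF_vfields[OF v(2)]
  let ?Z = "hol X" and ?W = "antihol Y" and ?C = "cbilin T (hol X) (antihol Y) p"
  have Z: "?Z \<in> cvfields (charts M)" "\<And>p. ?Z p \<in> H10 M p"
    using hol_csections[OF X] by (auto simp: csections_def)
  have W: "?W \<in> cvfields (charts M)" "\<And>p. ?W p \<in> H01 M p"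
    using antihol_csections[OF Y] by (auto simp: csections_def)
  have "on_fields (proj_plus M) ?Z = ?Z" "on_fields (proj_minus M) ?Z = 0"
    "on_fields (proj_minus M) ?W = ?W" "on_fields (proj_plus M) ?W = 0"
    using Z W by (simp_all add: on_fields_def fun_eq_iff[where 'a='a] proj_plus_H10 proj_minus_H10
        proj_plus_H01 proj_minus_H01)
  moreover have "Theta11 M D ?Z ?W p = 0"
    using canonical Z(1) W(1) by (simp add: canonical_connection_def)
  moreover have "re_vec \<circ> (0::'a cvfield) = 0" "im_vec \<circ> (0::'a cvfield) = 0"
    by (simp_all add: fun_eq_iff re_im_simps)
  then have "cbilin T 0 0 p = 0"
    by (intro cvec_eqI) (simp_all add: re_cbilin im_cbilin T_zero_left vfields_zero re_im_simps)
  ultimately have "proj_plus M p ?C = 0"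
    by (simp add: Theta11_def Theta_def on_fields_apply proj_plus_H10 zero_types)
  moreover have re: "re_vec ?C = T X Y p + T (JF X) (JF Y) p"
    "im_vec ?C = T X (JF Y) p - T (JF X) Y p"
    by (simp_all add: re_cbilin im_cbilin re_im_hol T_uminus_left v Jv)
  moreover have "re_vec ?C \<in> T_p p" "im_vec ?C \<in> T_p p"
    using re by (simp_all add: T_tangent v Jv tangent_space_intros)
  ultimately have "vscale (1/2) (P p (re_vec ?C) + J p (im_vec ?C)) = 0"
    using proj_plus_eq[of ?C p] by (metis re_cvec re_vec_zero)
  then show ?thesis by (simp add: re fun_eq_iff vscale_apply eq_neg_iff_add_eq_0)
qed

text \<open>Exchanging the arguments changes the sign of the left-hand side of the preceding identity
  and not of its right-hand side, so that both vanish.\<close>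

lemma torsion_J_J:
  assumes X: "X \<in> hsections" and Y: "Y \<in> hsections"
  shows "P p (T (JF X) (JF Y) p) = - P p (T X Y p)"
proof -
  note v = hsectionsD(1)[OF X] hsectionsD(1)[OF Y]
  note Jv = JF_vfields[OF v(1)] JF_vfields[OF v(2)]
  let ?l = "P p (T X Y p + T (JF X) (JF Y) p)" and ?r = "J p (T X (JF Y) p - T (JF X) Y p)"
  have "?l = - ?r" by (rule Theta_hol_antihol[OF X Y])
  moreover have "- ?l = - ?r"
  proof -
    have "T Y X p + T (JF Y) (JF X) p = - (T X Y p + T (JF X) (JF Y) p)"
      using T_flip[of Y X] T_flip[of "JF Y" "JF X"] by simp
    then have "- ?l = P p (T Y X p + T (JF Y) (JF X) p)"
      using proj_hor_uminus[OF tangent_space_add[OF T_tangent[OF v] T_tangent[OF Jv]]] by metis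
    also have "\<dots> = - J p (T Y (JF X) p - T (JF Y) X p)" by (rule Theta_hol_antihol[OF Y X])
    also have "T Y (JF X) p - T (JF Y) X p = T X (JF Y) p - T (JF X) Y p"
      using T_flip[of Y "JF X"] T_flip[of "JF Y" X] by simp
    finally show ?thesis .
  qed
  ultimately have "?l = - ?l" by metis
  then have "?l f = - ?l f" for f by (metis uminus_apply)
  then have "?l f = 0" for f by (metis equal_neg_zero)
  then show ?thesis
    by (simp add: proj_hor_add T_tangent v Jv fun_eq_iff eq_neg_iff_add_eq_0 add.commute)
qed

text \<open>Replacing \<open>X\<close> by \<open>JX\<close> in the preceding lemma shows that the two summands on the left-hand side
  of \<open>torsion_integrable\<close> have the same horizontal part. Its right-hand side is \<open>2 J T(X,Y)\<close>, again
  by the preceding lemma.\<close>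

lemma torsion_J_left:
  assumes X: "X \<in> hsections" and Y: "Y \<in> hsections"
  shows "P p (T (JF X) Y p) = J p (T X Y p)"
proof -
  note v = hsectionsD(1)[OF X] hsectionsD(1)[OF Y]
  note Jv = JF_vfields[OF v(1)] JF_vfields[OF v(2)]
  note t = T_tangent v Jv
  have 1: "P p (T X (JF Y) p) = P p (T (JF X) Y p)"
    using torsion_J_J[OF JF_hsections[OF v(1)] Y, of p]
    by (simp add: JF_JF X T_uminus_left proj_hor_uminus t)
  have "P p (T X (JF Y) p) + P p (T (JF X) Y p) = P p (T X (JF Y) p + T (JF X) Y p)"
    by (simp add: proj_hor_add t)
  also have "\<dots> = P p (J p (T X Y p - T (JF X) (JF Y) p))"
    by (simp add: torsion_integrable[OF X Y])
  also have "\<dots> = J p (P p (T X Y p - T (JF X) (JF Y) p))"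
    by (simp add: proj_hor_J J_proj_hor t tangent_space_diff)
  also have "P p (T X Y p - T (JF X) (JF Y) p) = P p (T X Y p) + P p (T X Y p)"
    by (simp add: proj_hor_diff t torsion_J_J[OF X Y])
  also have "J p \<dots> = J p (T X Y p) + J p (T X Y p)"
    unfolding J_add[OF hor_tangent[OF proj_hor_hor] hor_tangent[OF proj_hor_hor], OF T_tangent[OF v] T_tangent[OF v]]
      J_proj_hor[OF T_tangent[OF v]] ..
  finally show ?thesis by (simp add: 1 fun_eq_iff)
qed

lemma torsion_J_right:
  assumes X: "X \<in> hsections" and Y: "Y \<in> hsections"
  shows "P p (T X (JF Y) p) = J p (T X Y p)"
proof -
  note v = hsectionsD(1)[OF X] hsectionsD(1)[OF Y]
  have "P p (T X (JF Y) p) = - P p (T (JF Y) X p)"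
    using T_flip[of X "JF Y"] by (simp add: proj_hor_uminus T_tangent v JF_vfields)
  also have "\<dots> = J p (T X Y p)"
    using T_flip[of X Y] by (simp add: torsion_J_left[OF Y X] J_uminus T_tangent v)
  finally show ?thesis .
qed

lemma proj_plus_torsion_hol:
  assumes X: "X \<in> hsections" and Y: "Y \<in> hsections"
  shows "proj_plus M p (cbilin T (hol X) (hol Y) p)
    = cvec (vscale 2 (P p (T X Y p))) (- J p (vscale 2 (P p (T X Y p))))"
proof -
  note v = hsectionsD(1)[OF X] hsectionsD(1)[OF Y]
  note Jv = JF_vfields[OF v(1)] JF_vfields[OF v(2)]
  note t = T_tangent v Jv
  let ?C = "cbilin T (hol X) (hol Y) p"
  have re: "re_vec ?C = T X Y p - T (JF X) (JF Y) p"
    "im_vec ?C = - (T X (JF Y) p + T (JF X) Y p)"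
    by (simp_all add: re_cbilin im_cbilin re_im_hol T_uminus_left T_uminus_right v Jv vfields_uminus)
  have "P p (re_vec ?C) = vscale 2 (P p (T X Y p))"
    by (simp add: re proj_hor_diff t torsion_J_J[OF X Y]) (simp add: fun_eq_iff vscale_apply)
  moreover have S: "T X (JF Y) p + T (JF X) Y p \<in> T_p p"
    by (simp add: t tangent_space_add)
  have "P p (T X (JF Y) p + T (JF X) Y p) = vscale 2 (J p (T X Y p))"
    by (simp add: proj_hor_add t torsion_J_left[OF X Y] torsion_J_right[OF X Y])
      (simp add: fun_eq_iff vscale_apply)
  then have "J p (im_vec ?C) = - J p (vscale 2 (J p (T X Y p)))"
    unfolding re J_uminus[OF S] J_proj_hor[OF S, symmetric] by simp
  then have "J p (im_vec ?C) = vscale 2 (P p (T X Y p))"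
    by (simp add: J_vscale J_J J_tangent t) (simp add: fun_eq_iff vscale_apply)
  ultimately have "vscale (1/2) (P p (re_vec ?C) + J p (im_vec ?C)) = vscale 2 (P p (T X Y p))"
    by (simp add: fun_eq_iff vscale_apply)
  moreover have "re_vec ?C \<in> T_p p" "im_vec ?C \<in> T_p p"
    using re by (simp_all add: t tangent_space_intros)
  ultimately show ?thesis using proj_plus_eq[of ?C p] by simp
qed

text \<open>The (1,0) part of any smooth complex field has the form \<open>X - iJX\<close> with \<open>X\<close> horizontal and
  smooth, since \<open>J\<close> and the horizontal projection preserve smoothness. On such fields the preceding
  lemma computes \<open>\<Theta>\<close>.\<close>

lemma Theta20_zero_iff:
  "(\<forall>Z\<in>cvfields (charts M). \<forall>W\<in>cvfields (charts M). Theta20 M D Z W = 0) \<longleftrightarrow>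
   (\<forall>X\<in>hsections. \<forall>Y\<in>hsections. \<forall>p. P p (T X Y p) = 0)"
proof (intro iffI ballI allI)
  fix X Y p
  assume "\<forall>Z\<in>cvfields (charts M). \<forall>W\<in>cvfields (charts M). Theta20 M D Z W = 0"
    and X: "X \<in> hsections" and Y: "Y \<in> hsections"
  then have "Theta20 M D (hol X) (hol Y) p = 0"
    using hol_csections[OF X] hol_csections[OF Y] by (simp add: csections_def)
  moreover have "on_fields (proj_plus M) (hol X) = hol X" if "X \<in> hsections" for X
    using hol_csections[OF that] by (simp add: on_fields_def fun_eq_iff[where 'a='a] proj_plus_H10 csections_def)
  ultimately have "proj_plus M p (cbilin T (hol X) (hol Y) p) = 0"
    using X Y by (simp add: Theta20_def Theta_def on_fields_apply)
  from arg_cong[OF this, of re_vec] have "vscale 2 (P p (T X Y p)) = 0"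
    by (simp add: proj_plus_torsion_hol[OF X Y] re_cvec re_vec_zero)
  then show "P p (T X Y p) = 0" by (simp add: fun_eq_iff vscale_apply)
next
  fix Z W
  assume *: "\<forall>X\<in>hsections. \<forall>Y\<in>hsections. \<forall>p. P p (T X Y p) = 0"
    and Z: "Z \<in> cvfields (charts M)" and W: "W \<in> cvfields (charts M)"
  have ex: "\<exists>X\<in>hsections. on_fields (proj_plus M) Z = hol X" if Z: "Z \<in> cvfields (charts M)" for Z
  proof
    let ?X = "fscale (\<lambda>p. 1/2) (PF (re_vec \<circ> Z) + JF (im_vec \<circ> Z))"
    have v: "re_vec \<circ> Z \<in> \<X>" "im_vec \<circ> Z \<in> \<X>" using Z by (auto simp: cvfields_on_def)
    note h = hsectionsD[OF PF_hsections[OF v(1)]] hsectionsD[OF JF_hsections[OF v(2)]]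
    show "?X \<in> hsections"
      by (simp add: sections_def h vfields_fscale vfields_add smooth_funs_const fscale_apply
          hor_vscale hor_add)
    show "on_fields (proj_plus M) Z = hol ?X"
      using v[THEN vfield_tangent]
      by (intro ext) (simp add: on_fields_apply proj_plus_eq hol_def fscale_apply)
  qed
  obtain X Y where XY: "X \<in> hsections" "Y \<in> hsections"
    "on_fields (proj_plus M) Z = hol X" "on_fields (proj_plus M) W = hol Y"
    using ex[OF Z] ex[OF W] by blast
  have "Theta20 M D Z W p = 0" for p
  proof -
    have "Theta20 M D Z W p = cvec (vscale 2 0) (- J p (vscale 2 0))"
      using * XY by (simp add: Theta20_def Theta_def on_fields_apply proj_plus_torsion_hol)
    also have "\<dots> = 0"
      unfolding vscale_zero J_zero minus_zero by (rule cvec_zero)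
    finally show ?thesis .
  qed
  then show "Theta20 M D Z W = 0" by auto
qed

section \<open>The differential of the pseudo-Kaehler form\<close>

lemma Om_skew: "u \<in> T_p p \<Longrightarrow> v \<in> T_p p \<Longrightarrow> \<Omega> p u v = - \<Omega> p v u"
  by (simp add: pseudo_kaehler_form_def g_J_skew g_sym[of u p] J_tangent)

lemma Om_diff: "u \<in> T_p p \<Longrightarrow> v \<in> T_p p \<Longrightarrow> w \<in> T_p p \<Longrightarrow> \<Omega> p (u - v) w = \<Omega> p u w - \<Omega> p v w"
  by (simp add: pseudo_kaehler_form_def J_diff g_diff J_tangent)

lemma Om_vscale: "u \<in> T_p p \<Longrightarrow> w \<in> T_p p \<Longrightarrow> \<Omega> p (vscale c u) w = c * \<Omega> p u w"
  by (simp add: pseudo_kaehler_form_def J_vscale g_vscale J_tangent)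

lemma Om_uminus: "u \<in> T_p p \<Longrightarrow> w \<in> T_p p \<Longrightarrow> \<Omega> p (- u) w = - \<Omega> p u w"
  by (simp add: pseudo_kaehler_form_def J_uminus g_uminus J_tangent)

lemma Om_proj: "u \<in> T_p p \<Longrightarrow> \<Omega> p (P p u) w = \<Omega> p u w"
  by (simp add: pseudo_kaehler_form_def J_proj_hor)

lemma g_hor_right: "u \<in> \<H> p \<Longrightarrow> v \<in> T_p p \<Longrightarrow> g p u (P p v) = g p u v"
  using g_hor[of v p u] by (simp add: g_sym[of u] hor_tangent proj_hor_hor)

lemma Om_J: "u \<in> T_p p \<Longrightarrow> w \<in> T_p p \<Longrightarrow> \<Omega> p (J p u) (J p w) = \<Omega> p u w"
  unfolding pseudo_kaehler_form_def
  by (subst g_J_J) (simp_all add: J_tangent proj_hor_J g_hor_right J_hor)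

lemma Om_reeb: "u \<in> T_p p \<Longrightarrow> \<Omega> p u (\<xi> p) = 0"
  by (simp add: pseudo_kaehler_form_def g_J_skew J_reeb reeb_tangent J_tangent)
    (metis J_reeb J_tangent g_J_skew g_reeb form_J g_sym neg_equal_0_iff_equal reeb_tangent)

lemma D_Om:
  assumes "X \<in> \<X>" "Y \<in> \<X>" "Z \<in> \<X>"
  shows "X p (\<lambda>q. \<Omega> q (Y q) (Z q)) = \<Omega> p (D X Y p) (Z p) + \<Omega> p (Y p) (D X Z p)"
  using D_metric[OF assms(1) JF_vfields[OF assms(2)] assms(3), of p]
  by (simp add: pseudo_kaehler_form_def D_J assms) (simp add: on_fields_apply)

text \<open>As \<open>\<Omega>\<close> is parallel, its derivatives in \<open>d\<Omega>\<close> turn into covariant derivatives of the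
  arguments, which combine with the brackets to torsion terms.\<close>

lemma ext_d2_torsion:
  assumes X: "X \<in> \<X>" and Y: "Y \<in> \<X>" and Z: "Z \<in> \<X>"
  shows "3 * ext_d2 \<Omega> X Y Z p
    = \<Omega> p (T X Y p) (Z p) + \<Omega> p (T Y Z p) (X p) + \<Omega> p (T Z X p) (Y p)"
proof -
  note t = vfield_tangent[OF D_vfields] vfield_tangent[OF vfields_lie_bracket] vfield_tangent
    tangent_space_diff X Y Z
  have T: "\<Omega> p (T X Y p) (Z p)
      = \<Omega> p (D X Y p) (Z p) - \<Omega> p (D Y X p) (Z p) - \<Omega> p (lie_bracket X Y p) (Z p)"
    if "X \<in> \<X>" "Y \<in> \<X>" "Z \<in> \<X>" for X Y Z
    using that by (simp add: torsion_def Om_diff t)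
  have s: "\<Omega> p (X p) (D Y Z p) = - \<Omega> p (D Y Z p) (X p)"
    if "X \<in> \<X>" "Y \<in> \<X>" "Z \<in> \<X>" for X Y Z
    using that by (intro Om_skew) (simp_all add: t)
  show ?thesis
    by (simp add: ext_d2_def D_Om T s X Y Z)
qed

lemma sigma_hsections: assumes "X \<in> \<X>" shows "\<sigma> X \<in> hsections"
proof -
  note a = hsectionsD[OF tau_hsections[OF JF_vfields[OF assms]]]
    hsectionsD[OF JF_hsections[OF hsectionsD(1)[OF tau_hsections[OF assms]]]]
  show ?thesis
    unfolding sections_def tor_sigma_def using a by (simp add: vfields_add hor_add)
qed

lemma sigma_skew:
  assumes X: "X \<in> \<X>" and Y: "Y \<in> \<X>"
  shows "g p (\<sigma> X p) (Y p) = - g p (X p) (\<sigma> Y p)"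
proof -
  have "htensor M p (\<sigma> X p) (Y p) = - htensor M p (X p) (\<sigma> Y p)"
    using canonical X Y by (simp add: canonical_connection_def)
  moreover have "\<theta> p (\<sigma> X p) = 0" "\<theta> p (\<sigma> Y p) = 0"
    using hsectionsD(2)[OF sigma_hsections] X Y by (auto simp: hor_iff)
  ultimately show ?thesis by (simp add: gmetric_def)
qed

lemma sigma_apply: "\<sigma> X p = \<tau> (JF X) p + J p (\<tau> X p)"
  by (simp add: tor_sigma_def on_fields_apply)

text \<open>The identity \<open>d\<Omega> = 0\<close> at \<open>(X,Y,Z)\<close> and at \<open>(JX,JY,Z)\<close> differ by the sign of the first of three
  terms, which hence is zero. The choice \<open>Z = J T(X,Y)\<close> makes it the squared length of \<open>J T(X,Y)\<close>.\<close>

lemma kaehler_imp_torsion_free: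
  assumes K: "pseudo_kaehler_type M" and X: "X \<in> hsections" and Y: "Y \<in> hsections"
  shows "P p (T X Y p) = 0"
proof -
  have K': "\<Omega> p (T X Y p) (Z p) + \<Omega> p (T Y Z p) (X p) + \<Omega> p (T Z X p) (Y p) = 0"
    if "X \<in> \<X>" "Y \<in> \<X>" "Z \<in> \<X>" for X Y Z
    using ext_d2_torsion[OF that, of p] K that by (simp add: pseudo_kaehler_type_def)
  define Z where "Z = JF (T X Y)"
  note v = hsectionsD(1)[OF X] hsectionsD(1)[OF Y]
  note Jv = JF_vfields[OF v(1)] JF_vfields[OF v(2)]
  have Z: "Z \<in> hsections" using JF_hsections T_vfields v by (simp add: Z_def)
  note Zv = hsectionsD(1)[OF Z]
  note t = T_tangent v Jv Zv vfield_tangent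
  have "\<Omega> p (T (JF X) (JF Y) p) (Z p) = - \<Omega> p (T X Y p) (Z p)"
    using arg_cong[OF torsion_J_J[OF X Y, of p], of "\<lambda>u. \<Omega> p u (Z p)"]
    by (simp add: Om_proj Om_uminus t hor_tangent proj_hor_hor)
  moreover have "\<Omega> p (T (JF Y) Z p) (JF X p) = \<Omega> p (T Y Z p) (X p)"
    using arg_cong[OF torsion_J_left[OF Y Z, of p], of "\<lambda>u. \<Omega> p u (JF X p)"]
    by (simp add: Om_proj t) (simp add: on_fields_apply Om_J t)
  moreover have "\<Omega> p (T Z (JF X) p) (JF Y p) = \<Omega> p (T Z X p) (Y p)"
    using arg_cong[OF torsion_J_right[OF Z X, of p], of "\<lambda>u. \<Omega> p u (JF Y p)"]
    by (simp add: Om_proj t) (simp add: on_fields_apply Om_J t)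
  ultimately have "\<Omega> p (T X Y p) (Z p) = 0"
    using K'[OF v Zv] K'[OF Jv Zv] by simp
  then have "J p (T X Y p) = 0"
    by (intro g_definite[of _ p]) (simp_all add: Z_def pseudo_kaehler_form_def on_fields_apply J_tangent t)
  then have "J p (J p (T X Y p)) = 0" by (simp add: J_zero)
  then show ?thesis by (simp add: J_J t)
qed

text \<open>This is \<open>d\<Omega>(\<xi>,X,Y) = 0\<close>, in which the term \<open>\<Omega>(T(X,Y),\<xi>)\<close> drops out.\<close>

lemma kaehler_imp_tau:
  assumes K: "pseudo_kaehler_type M" and X: "X \<in> \<X>" and Y: "Y \<in> \<X>"
  shows "g p (J p (\<tau> X p)) (Y p) = - g p (J p (X p)) (\<tau> Y p)"
proof -
  have "\<Omega> p (\<tau> X p) (Y p) + \<Omega> p (T X Y p) (\<xi> p) + \<Omega> p (T Y \<xi> p) (X p) = 0"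
    using ext_d2_torsion[OF reeb_field X Y, of p] K X Y reeb_field
    by (simp add: pseudo_kaehler_type_def tor_tau_def)
  moreover have "T Y \<xi> p = - \<tau> Y p"
    using T_flip[of Y \<xi>] by (simp add: tor_tau_def)
  moreover note t = vfield_tangent[OF X] vfield_tangent[OF Y] T_tangent[OF X Y]
    vfield_tangent[OF hsectionsD(1)[OF tau_hsections[OF X]]]
    vfield_tangent[OF hsectionsD(1)[OF tau_hsections[OF Y]]]
  ultimately have "\<Omega> p (\<tau> X p) (Y p) = \<Omega> p (\<tau> Y p) (X p)"
    by (simp add: Om_reeb Om_uminus t)
  then show ?thesis
    using t by (simp add: pseudo_kaehler_form_def g_J_skew[of "\<tau> Y p"] g_sym[of "\<tau> Y p"] J_tangent)
qed

text \<open>The preceding identity expresses the adjoint of \<open>\<tau>\<close> as \<open>J \<tau> J\<close>. Hence \<open>\<sigma> = \<tau> J + J \<tau>\<close> is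
  self-adjoint, and being skew as well it is zero. Then \<open>J \<tau> J = - J J \<tau> = \<tau>\<close>.\<close>

lemma kaehler_imp_sigma_tau:
  assumes K: "pseudo_kaehler_type M"
  shows "X \<in> \<X> \<Longrightarrow> \<sigma> X = 0"
    and "X \<in> \<X> \<Longrightarrow> Y \<in> \<X> \<Longrightarrow> g p (\<tau> X p) (Y p) = g p (X p) (\<tau> Y p)"
proof -
  have tt: "\<tau> X p \<in> T_p p" and th: "\<tau> X p \<in> \<H> p" if "X \<in> \<X>" for X p
    using vfield_tangent[OF hsectionsD(1)[OF tau_hsections[OF that]]]
      hsectionsD(2)[OF tau_hsections[OF that]] by auto
  note t = vfield_tangent JF_vfields tt J_tangent tangent_space_intros
  \<comment> \<open>The adjoint of \<open>\<tau>\<close> is \<open>J \<tau> J\<close>.\<close>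
  have b: "g p (J p (\<tau> (JF X) p)) (Y p) = g p (X p) (\<tau> Y p)"
    if X: "X \<in> \<X>" and Y: "Y \<in> \<X>" for X Y p
    using kaehler_imp_tau[OF K JF_vfields[OF X] Y, of p] X Y
    by (simp add: on_fields_apply J_J g_uminus t hor_tangent proj_hor_hor g_hor th)
  have c: "g p (\<tau> (JF X) p) (Y p) = g p (X p) (\<tau> (JF Y) p)"
    if X: "X \<in> \<X>" and Y: "Y \<in> \<X>" for X Y p
  proof -
    have "g p (J p (\<tau> (JF X) p)) (J p (Y p)) = g p (\<tau> (JF X) p) (P p (Y p))"
      using X Y by (simp add: g_J_J t proj_hor_id th)
    also have "\<dots> = g p (\<tau> (JF X) p) (Y p)"
      using X Y g_hor[OF vfield_tangent[OF Y] th[OF JF_vfields[OF X]], of p]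
      by (simp add: g_sym t hor_tangent proj_hor_hor)
    finally show ?thesis using b[OF X JF_vfields[OF Y], of p] by (simp add: on_fields_apply)
  qed
  have "g p (\<sigma> X p) (Y p) = g p (X p) (\<sigma> Y p)" if X: "X \<in> \<X>" and Y: "Y \<in> \<X>" for X Y p
  proof -
    have "g p (\<sigma> X p) (Y p) = g p (\<tau> (JF X) p) (Y p) + g p (J p (\<tau> X p)) (Y p)"
      using X Y by (simp add: sigma_apply g_add t)
    also have "\<dots> = g p (X p) (\<tau> (JF Y) p) - g p (J p (X p)) (\<tau> Y p)"
      by (simp add: c[OF X Y] kaehler_imp_tau[OF K X Y])
    also have "\<dots> = g p (\<tau> (JF Y) p) (X p) + g p (J p (\<tau> Y p)) (X p)"
      using X Y by (simp add: g_J_skew g_sym[of "X p"] t)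
    also have "\<dots> = g p (X p) (\<sigma> Y p)"
      using X Y by (simp add: sigma_apply g_add g_sym[of "X p"] t)
    finally show ?thesis .
  qed
  then have z: "g p (\<sigma> X p) (Y p) = 0" if "X \<in> \<X>" "Y \<in> \<X>" for X Y p
    using sigma_skew[OF that, of p] that by simp
  show s: "\<sigma> X = 0" if "X \<in> \<X>" for X
  proof
    fix p
    note s = hsectionsD(1)[OF sigma_hsections[OF that]]
    show "\<sigma> X p = 0 p" using g_definite[OF vfield_tangent[OF s] z[OF that s]] by simp
  qed
  show "g p (\<tau> X p) (Y p) = g p (X p) (\<tau> Y p)" if X: "X \<in> \<X>" and Y: "Y \<in> \<X>" for X Y
  proof -
    have "\<tau> (JF X) p = - J p (\<tau> X p)"
      using fun_cong[OF s[OF X], of p] by (simp add: sigma_apply eq_neg_iff_add_eq_0)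
    then have "J p (\<tau> (JF X) p) = \<tau> X p"
      using X by (simp add: J_uminus J_J t proj_hor_id th)
    then show ?thesis using b[OF X Y, of p] by simp
  qed
qed

text \<open>The torsion is tensorial, so splitting off the \<open>\<xi>\<close>-components of \<open>X\<close> and \<open>Y\<close> leaves only values
  of \<open>\<tau>\<close> and the torsion of horizontal fields.\<close>

lemma torsion_decomposition:
  assumes N: "\<And>X Y. X \<in> hsections \<Longrightarrow> Y \<in> hsections \<Longrightarrow> P p (T X Y p) = 0"
    and X: "X \<in> \<X>" and Y: "Y \<in> \<X>"
  shows "P p (T X Y p) = vscale (\<theta> p (X p)) (\<tau> Y p) - vscale (\<theta> p (Y p)) (\<tau> X p)"
proof -
  have split: "T X Y p = T (PF X) Y p + vscale (\<theta> p (X p)) (\<tau> Y p)"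
    if X: "X \<in> \<X>" and Y: "Y \<in> \<X>" for X Y
  proof -
    have "T X Y = T (PF X) Y + T (fscale (\<lambda>p. \<theta> p (X p)) \<xi>) Y"
      using field_decomp[OF X] T_add_left[OF PF_vfields[OF X] vfields_fscale[OF form_smooth[OF X] reeb_field] Y]
      by simp
    then show ?thesis
      by (simp add: T_fscale_left form_smooth X Y reeb_field tor_tau_def fscale_apply)
  qed
  have tau: "\<tau> (PF X) p = \<tau> X p"
    using split[OF X reeb_field] T_flip[of X \<xi>] T_flip[of "PF X" \<xi>]
    by (simp add: tau_reeb tor_tau_def[symmetric]) (simp add: fun_eq_iff vscale_apply)
  have tt: "\<tau> X \<in> hsections" "\<tau> Y \<in> hsections" using tau_hsections X Y by auto
  note t = vfield_tangent[OF hsectionsD(1)[OF tt(1)]] vfield_tangent[OF hsectionsD(1)[OF tt(2)]]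
    hsectionsD(2)[OF tt(1)] hsectionsD(2)[OF tt(2)] T_tangent PF_vfields X Y
  have "T X Y p = - T Y (PF X) p + vscale (\<theta> p (X p)) (\<tau> Y p)"
    using split[OF X Y] T_flip[of "PF X" Y] by simp
  moreover have "T Y (PF X) p = T (PF Y) (PF X) p + vscale (\<theta> p (Y p)) (\<tau> X p)"
    using split[OF Y PF_vfields[OF X]] by (simp add: tau)
  ultimately have e: "T X Y p = - (T (PF Y) (PF X) p + vscale (\<theta> p (Y p)) (\<tau> X p))
      + vscale (\<theta> p (X p)) (\<tau> Y p)"
    by (rule trans[OF _ arg_cong])
  show ?thesis
    by (subst e) (simp add: proj_hor_add proj_hor_diff proj_hor_uminus proj_hor_vscale t
        tangent_space_intros N PF_hsections proj_hor_id)
qed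

text \<open>In the cyclic sum each of \<open>\<theta>(X)\<close>, \<open>\<theta>(Y)\<close>, \<open>\<theta>(Z)\<close> is multiplied by a difference such as
  \<open>\<Omega>(\<tau>Y,Z) - \<Omega>(\<tau>Z,Y)\<close>. It is zero because \<open>J\<tau> = - \<tau>J\<close> and \<open>\<tau>\<close> is symmetric.\<close>

lemma kaehler_if_torsion:
  assumes N: "\<And>X Y p. X \<in> hsections \<Longrightarrow> Y \<in> hsections \<Longrightarrow> P p (T X Y p) = 0"
    and s: "\<And>X. X \<in> \<X> \<Longrightarrow> \<sigma> X = 0"
    and sym: "\<And>X Y p. X \<in> \<X> \<Longrightarrow> Y \<in> \<X> \<Longrightarrow> g p (\<tau> X p) (Y p) = g p (X p) (\<tau> Y p)"
  shows "pseudo_kaehler_type M"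
  unfolding pseudo_kaehler_type_def
proof (intro ballI allI)
  fix X Y Z p assume XYZ: "X \<in> \<X>" "Y \<in> \<X>" "Z \<in> \<X>"
  have tt: "\<tau> X p \<in> T_p p" if "X \<in> \<X>" for X
    using vfield_tangent[OF hsectionsD(1)[OF tau_hsections[OF that]]] .
  have Os: "\<Omega> p (\<tau> X p) (Y p) = \<Omega> p (\<tau> Y p) (X p)" if X: "X \<in> \<X>" and Y: "Y \<in> \<X>" for X Y
  proof -
    have "J p (\<tau> X p) = - \<tau> (JF X) p"
      using fun_cong[OF s[OF X], of p] by (simp add: sigma_apply eq_neg_iff_add_eq_0 add.commute)
    then have "\<Omega> p (\<tau> X p) (Y p) = - g p (\<tau> (JF X) p) (Y p)"
      using X Y by (simp add: pseudo_kaehler_form_def g_uminus tt JF_vfields vfield_tangent)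
    also have "\<dots> = - g p (J p (X p)) (\<tau> Y p)"
      using sym[OF JF_vfields[OF X] Y, of p] by (simp add: on_fields_apply)
    also have "\<dots> = \<Omega> p (\<tau> Y p) (X p)"
      using X Y by (simp add: pseudo_kaehler_form_def g_J_skew g_sym[of "X p"] tt J_tangent vfield_tangent)
    finally show ?thesis .
  qed
  have OT: "\<Omega> p (T X Y p) (Z p)
      = \<theta> p (X p) * \<Omega> p (\<tau> Y p) (Z p) - \<theta> p (Y p) * \<Omega> p (\<tau> X p) (Z p)"
    if "X \<in> \<X>" "Y \<in> \<X>" "Z \<in> \<X>" for X Y Z
    using arg_cong[OF torsion_decomposition[OF N that(1,2), of p], of "\<lambda>u. \<Omega> p u (Z p)"] that
    by (simp add: Om_proj Om_diff Om_vscale tt vfield_tangent T_tangent tangent_space_vscale)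
  have "3 * ext_d2 \<Omega> X Y Z p = 0"
    unfolding ext_d2_torsion[OF XYZ] using Os[OF XYZ(1,2)] Os[OF XYZ(2,3)] Os[OF XYZ(1,3)]
    by (simp add: OT XYZ)
  then show "ext_d2 \<Omega> X Y Z p = 0" by simp
qed

end

section \<open>Characterisation of pseudo-Kaehler type\<close>

theorem theorem3:
  fixes M :: "('a::{t2_space, second_countable_topology}, 'n::finite) pseudo_hermitian"
    and m :: nat and D :: "'a connection"
  assumes "pseudo_hermitian_manifold m M"
    and "canonical_connection M D"
  shows "pseudo_kaehler_type M \<longleftrightarrow>
      (\<forall>Z\<in>cvfields (charts M). \<forall>W\<in>cvfields (charts M). Theta20 M D Z W = 0) \<and>
      (\<forall>X\<in>vfields (charts M). tor_sigma M D X = 0) \<and>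
      symmetric_wrt (charts M) (gmetric M) (tor_tau M D)"
proof -
  interpret canonical_ph_manifold M m D
    using assms by unfold_locales
  show ?thesis
    unfolding Theta20_zero_iff symmetric_wrt_def
  proof (intro iffI conjI ballI allI)
    assume K: "pseudo_kaehler_type M"
    show "P p (T X Y p) = 0" if "X \<in> hsections" "Y \<in> hsections" for X Y p
      by (rule kaehler_imp_torsion_free[OF K that])
    show "\<sigma> X = 0" if "X \<in> \<X>" for X
      by (rule kaehler_imp_sigma_tau(1)[OF K that])
    show "g p (\<tau> X p) (Y p) = g p (X p) (\<tau> Y p)" if "X \<in> \<X>" "Y \<in> \<X>" for X Y p
      by (rule kaehler_imp_sigma_tau(2)[OF K that])
  qed (auto intro!: kaehler_if_torsion)
qed

end
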